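(* For every integer $n>2$: (1) the number of unlabeled connected point-determining graphs with $n$ vertices equals the number of unlabeled connected co-point-determining graphs with $n$ vertices; (2) the number of labeled connected point-determining graphs on the vertex set $\{1,\dots,n\}$ and the number of labeled connected co-point-determining graphs on the vertex set $\{1,\dots,n\}$ differ by $(n-1)!$ (that is, the absolute value of their difference is $(n-1)!$).
   Context: All graphs are finite and simple. The neighborhood of a vertex is the set of vertices adjacent to it. A graph is point-determining if distinct vertices have distinct neighborhoods; it is co-point-determining if its complement is point-determining. An unlabeled graph is an isomorphism class of graphs. *)

theory Defs
  imports Complex_Main "Graph_Theory.Graph_Theory"
begin

definition neighborhood :: "'a pair_pre_digraph \<Rightarrow> 'a \<Rightarrow> 'a set" where
  "neighborhood G v = {w \<in> pverts G. (v, w) \<in> parcs G}"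

definition point_determining :: "'a pair_pre_digraph \<Rightarrow> bool" where
  "point_determining G \<longleftrightarrow>
     (\<forall>u\<in>pverts G. \<forall>v\<in>pverts G. u \<noteq> v \<longrightarrow> neighborhood G u \<noteq> neighborhood G v)"

definition graph_complement :: "'a pair_pre_digraph \<Rightarrow> 'a pair_pre_digraph" where
  "graph_complement G =
     \<lparr> pverts = pverts G,
       parcs = {(u, v). u \<in> pverts G \<and> v \<in> pverts G \<and> u \<noteq> v \<and> (u, v) \<notin> parcs G} \<rparr>"

lemma pair_graph_graph_complement:
  assumes "pair_graph G"
  shows "pair_graph (graph_complement G)"
proof -
  interpret pair_graph G by fact
  have "parcs (graph_complement G) \<subseteq> pverts G \<times> pverts G"
    by (auto simp: graph_complement_def)
  then have "finite (parcs (graph_complement G))"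
    by (rule finite_subset) (simp add: pair_finite_verts)
  moreover have "sym (parcs G)"
    using pair_sym_arcs by (simp add: symmetric_def)
  ultimately show ?thesis
    by unfold_locales
      (auto simp: graph_complement_def pair_finite_verts symmetric_def sym_def)
qed

definition co_point_determining :: "'a pair_pre_digraph \<Rightarrow> bool" where
  "co_point_determining G \<longleftrightarrow> point_determining (graph_complement G)"

text \<open>Every finite graph is isomorphic to one whose vertices are natural numbers, so
  the isomorphism classes of finite simple graphs are represented by the classes of
  this relation.\<close>

definition graph_iso_rel :: "nat pair_pre_digraph rel" where
  "graph_iso_rel =
     {(G, H). pair_graph G \<and> pair_graph H \<and> digraph_iso (with_proj G) (with_proj H)}"

lemma digraph_iso_with_proj_iff:
  assumes "pair_graph G" "pair_graph H"
  shows "digraph_iso (with_proj G) (with_proj H) \<longleftrightarrow>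
    (\<exists>f. bij_betw f (pverts G) (pverts H) \<and>
      (\<forall>u\<in>pverts G. \<forall>v\<in>pverts G. (u, v) \<in> parcs G \<longleftrightarrow> (f u, f v) \<in> parcs H))"
proof
  interpret G: pair_graph G by fact
  interpret H: pair_graph H by fact
  {
    assume "digraph_iso (with_proj G) (with_proj H)"
    then obtain h where h: "pre_digraph.digraph_isomorphism (with_proj G) h"
      and H: "with_proj H = app_iso h (with_proj G)"
      by (auto simp: digraph_iso_def)
    let ?f = "iso_verts h"
    have v: "pverts H = ?f ` pverts G" and a: "parcs H = iso_arcs h ` parcs G"
      and t: "iso_tail h = fst" and hd: "iso_head h = snd"
      using H by (auto simp: with_proj_def app_iso_def)
    have inj: "inj_on ?f (pverts G)"
      using h by (simp add: pre_digraph.digraph_isomorphism_def)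
    have arc: "iso_arcs h e = (?f (fst e), ?f (snd e))" if "e \<in> parcs G" for e
      using h that t hd by (auto simp: pre_digraph.digraph_isomorphism_def prod_eq_iff)
    have "(u, v) \<in> parcs G \<longleftrightarrow> (?f u, ?f v) \<in> parcs H"
      if uv: "u \<in> pverts G" "v \<in> pverts G" for u v
    proof
      assume "(u, v) \<in> parcs G"
      then show "(?f u, ?f v) \<in> parcs H" using a arc by force
    next
      assume "(?f u, ?f v) \<in> parcs H"
      then obtain x y where xy: "(x, y) \<in> parcs G" "?f u = ?f x" "?f v = ?f y"
        using a arc by force
      then have "x = u" "y = v"
        using inj uv G.in_arcsD1[OF xy(1)] G.in_arcsD2[OF xy(1)] by (auto dest: inj_onD)
      then show "(u, v) \<in> parcs G" using xy by simp
    qed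
    with v inj show "\<exists>f. bij_betw f (pverts G) (pverts H) \<and>
      (\<forall>u\<in>pverts G. \<forall>v\<in>pverts G. (u, v) \<in> parcs G \<longleftrightarrow> (f u, f v) \<in> parcs H)"
      by (auto simp: bij_betw_def)
  next
    assume "\<exists>f. bij_betw f (pverts G) (pverts H) \<and>
      (\<forall>u\<in>pverts G. \<forall>v\<in>pverts G. (u, v) \<in> parcs G \<longleftrightarrow> (f u, f v) \<in> parcs H)"
    then obtain f where inj: "inj_on f (pverts G)" and im: "f ` pverts G = pverts H"
      and e: "\<And>u v. u \<in> pverts G \<Longrightarrow> v \<in> pverts G \<Longrightarrow>
        (u, v) \<in> parcs G \<longleftrightarrow> (f u, f v) \<in> parcs H"
      by (auto simp: bij_betw_def)
    let ?h = "\<lparr> iso_verts = f, iso_arcs = map_prod f f, iso_head = snd, iso_tail = fst \<rparr>"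
    have sub: "parcs G \<subseteq> pverts G \<times> pverts G"
      using G.in_arcsD1 G.in_arcsD2 by auto
    have "inj_on (map_prod f f) (parcs G)"
      using map_prod_inj_on[OF inj inj] sub by (rule inj_on_subset)
    then have "pre_digraph.digraph_isomorphism (with_proj G) ?h"
      using inj G.wf_digraph by (auto simp: pre_digraph.digraph_isomorphism_def)
    moreover have "parcs H = map_prod f f ` parcs G"
    proof
      show "parcs H \<subseteq> map_prod f f ` parcs G"
      proof
        fix p assume p: "p \<in> parcs H"
        have "fst p \<in> f ` pverts G" "snd p \<in> f ` pverts G"
          unfolding im using p by (auto intro: H.arc_fst_in_verts H.arc_snd_in_verts)
        then obtain x y where xy: "x \<in> pverts G" "y \<in> pverts G" "p = (f x, f y)"
          by (metis imageE prod.collapse)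
        with p e show "p \<in> map_prod f f ` parcs G" by force
      qed
      show "map_prod f f ` parcs G \<subseteq> parcs H" using e sub by auto
    qed
    ultimately show "digraph_iso (with_proj G) (with_proj H)"
      unfolding digraph_iso_def using im
      by (intro exI[of _ ?h]) (auto simp: with_proj_def app_iso_def)
  }
qed

lemma equiv_graph_iso_rel: "equiv {G. pair_graph G} graph_iso_rel"
proof (rule equivI)
  show "graph_iso_rel \<subseteq> {G. pair_graph G} \<times> {G. pair_graph G}"
    by (auto simp: graph_iso_rel_def)
  show "refl_on {G. pair_graph G} graph_iso_rel"
    by (auto simp: refl_on_def graph_iso_rel_def digraph_iso_with_proj_iff
        intro!: exI[of _ id])
  show "sym graph_iso_rel"
    by (auto simp: sym_def graph_iso_rel_def wf_digraph_wp_iff pair_graph_def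
        pair_digraph_def pair_fin_digraph_def intro: digraph_iso_swap)
  show "trans graph_iso_rel"
    by (auto simp: trans_def graph_iso_rel_def intro: digraph_iso_trans)
qed

definition unlabeled_graphs :: "nat \<Rightarrow> (nat pair_pre_digraph \<Rightarrow> bool) \<Rightarrow> nat pair_pre_digraph set set" where
  "unlabeled_graphs n P =
     {G. pair_graph G \<and> card (pverts G) = n \<and> P G} // graph_iso_rel"

definition labeled_graphs :: "nat \<Rightarrow> (nat pair_pre_digraph \<Rightarrow> bool) \<Rightarrow> nat pair_pre_digraph set" where
  "labeled_graphs n P = {G. pair_graph G \<and> pverts G = {1..n} \<and> P G}"

end

theory Submission
  imports Defs "HOL-Library.Multiset" "HOL-Computational_Algebra.Formal_Power_Series"
begin

text \<open>
  Complementation matches point-determining graphs with co-point-determining graphs, so among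
  all graphs with \<open>n\<close> vertices, labelled or unlabelled, both kinds are equally frequent
  (\<open>card_unlabeled_complement\<close>, \<open>card_labeled_complement\<close>). The theorem compares how the two
  totals are built from connected graphs.

  A graph is co-point-determining iff distinct vertices have distinct closed neighborhoods, and this
  can be tested on each component separately: a co-point-determining graph is an arbitrary disjoint
  union of connected ones. For point-determining graphs the same is true except that at most
  one component may be a single vertex (\<open>point_determining_isolated_iff\<close>).

  Unlabelled graphs correspond to multisets of connected isomorphism classes
  (\<open>component_classes_image\<close>). Trade \<open>k\<close> isolated vertices on the co-point-determining side for
  \<open>k div 2\<close> components that are a single edge and \<open>k mod 2\<close> isolated vertices on the
  point-determining side: the point is connected and co-point-determining, the edge is connected and
  point-determining, and neither has more than two vertices. Hence the remaining connected classes on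
  both sides admit equally many multisets of each weight
  (\<open>multiset_count_connected_classes_eq\<close>), and the number of classes of each order can be
  recovered from these counts (\<open>weighted_atoms_unique\<close>).

  For labelled graphs let \<open>A\<close> be the exponential generating function common to both
  properties, \<open>Z\<close> the one of point-determining graphs without isolated vertices, and \<open>C\<close> and
  \<open>Q\<close> those of the connected graphs counted by \<open>Z\<close> and of the connected
  co-point-determining graphs. Then \<open>A = (1 + x) Z\<close>
  (\<open>card_labeled_point_determining\<close>), while looking at the component of one vertex gives
  \<open>A' = Q' A\<close> and \<open>Z' = C' Z\<close> (\<open>card_labeled_Suc\<close>). Therefore \<open>Q' - C' = 1 / (1 + x)\<close>,
  whose \<open>n\<close>-th coefficient is \<open>(-1) ^ n\<close>; this is the difference \<open>(n - 1)!\<close>, since with at least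
  two vertices a connected graph has no isolated vertex.
\<close>

section \<open>Separated vertex sets and components\<close>

lemma pair_graph_iff:
  "pair_graph G \<longleftrightarrow> finite (pverts G) \<and> parcs G \<subseteq> pverts G \<times> pverts G \<and> sym (parcs G) \<and> irrefl (parcs G)"
proof
  assume "pair_graph G"
  then interpret pair_graph G .
  show "finite (pverts G) \<and> parcs G \<subseteq> pverts G \<times> pverts G \<and> sym (parcs G) \<and> irrefl (parcs G)"
    using pair_sym_arcs pair_finite_verts
    by (auto simp: symmetric_def irrefl_def dest: in_arcsD1 in_arcsD2 pair_no_loops)
next
  assume *: "finite (pverts G) \<and> parcs G \<subseteq> pverts G \<times> pverts G \<and> sym (parcs G) \<and> irrefl (parcs G)"
  then have "finite (parcs G)"
    by (meson finite_SigmaI finite_subset)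
  with * show "pair_graph G"
    by unfold_locales (auto simp: symmetric_def irrefl_def)
qed

lemma pair_graph_sym: "pair_graph G \<Longrightarrow> (u, v) \<in> parcs G \<Longrightarrow> (v, u) \<in> parcs G"
  by (auto simp: pair_graph_iff dest: symD)

lemma pair_graph_verts:
  "pair_graph G \<Longrightarrow> (u, v) \<in> parcs G \<Longrightarrow> u \<in> pverts G"
  "pair_graph G \<Longrightarrow> (u, v) \<in> parcs G \<Longrightarrow> v \<in> pverts G"
  by (auto simp: pair_graph_iff)

lemma pair_graph_finite: "pair_graph G \<Longrightarrow> finite (pverts G)"
  by (simp add: pair_graph_iff)

text \<open>Connectedness, components and gluing are all phrased through unions of components: a vertex set
  with no arc leaving it. Paths then occur only in \<open>conn_iff_separated\<close>.\<close>

definition separated :: "'a pair_pre_digraph \<Rightarrow> 'a set \<Rightarrow> bool" where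
  "separated G S \<longleftrightarrow> S \<subseteq> pverts G \<and> (\<forall>(u, v) \<in> parcs G. u \<in> S \<longleftrightarrow> v \<in> S)"

lemma separatedI:
  "S \<subseteq> pverts G \<Longrightarrow> (\<And>u v. (u, v) \<in> parcs G \<Longrightarrow> u \<in> S \<longleftrightarrow> v \<in> S) \<Longrightarrow> separated G S"
  unfolding separated_def by fast

definition induced :: "'a pair_pre_digraph \<Rightarrow> 'a set \<Rightarrow> 'a pair_pre_digraph" where
  "induced G S = \<lparr> pverts = S, parcs = parcs G \<inter> S \<times> S \<rparr>"

definition glue :: "'a pair_pre_digraph \<Rightarrow> 'a pair_pre_digraph \<Rightarrow> 'a pair_pre_digraph" where
  "glue G H = \<lparr> pverts = pverts G \<union> pverts H, parcs = parcs G \<union> parcs H \<rparr>"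

abbreviation conn :: "'a pair_pre_digraph \<Rightarrow> bool" where
  "conn G \<equiv> Digraph_Component.connected (with_proj G)"

lemma conn_iff_separated:
  assumes "pair_graph G"
  shows "conn G \<longleftrightarrow> pverts G \<noteq> {} \<and> (\<forall>S. separated G S \<longrightarrow> S = {} \<or> S = pverts G)"
proof -
  interpret pair_graph G by fact
  have sym: "mk_symmetric (with_proj G) = G"
    using pair_graph_sym[OF assms]
    by (intro pair_pre_digraph.equality) (auto simp: mk_symmetric_def)
  have conn: "conn G \<longleftrightarrow> pverts G \<noteq> {} \<and> (\<forall>u\<in>pverts G. \<forall>v\<in>pverts G. u \<rightarrow>\<^sup>*\<^bsub>with_proj G\<^esub> v)"
    unfolding Digraph_Component.connected_def strongly_connected_def sym by simp
  show ?thesis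
  proof
    assume c: "conn G"
    have "S = pverts G" if S: "separated G S" "S \<noteq> {}" for S
    proof -
      obtain u where u: "u \<in> S" using S by auto
      have "v \<in> S" if "v \<in> pverts G" for v
      proof -
        have "u \<rightarrow>\<^sup>*\<^bsub>with_proj G\<^esub> v" using c conn u that S by (auto simp: separated_def)
        then show ?thesis
          by (induct rule: reachable_induct) (use u S in \<open>auto simp: separated_def\<close>)
      qed
      with S show ?thesis by (auto simp: separated_def)
    qed
    with c conn show "pverts G \<noteq> {} \<and> (\<forall>S. separated G S \<longrightarrow> S = {} \<or> S = pverts G)" by blast
  next
    assume r: "pverts G \<noteq> {} \<and> (\<forall>S. separated G S \<longrightarrow> S = {} \<or> S = pverts G)"
    have "u \<rightarrow>\<^sup>*\<^bsub>with_proj G\<^esub> v" if uv: "u \<in> pverts G" "v \<in> pverts G" for u v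
    proof -
      let ?S = "{w. u \<rightarrow>\<^sup>*\<^bsub>with_proj G\<^esub> w}"
      have "separated G ?S"
        using reachable_adj_trans[of u] pair_graph_sym[OF assms]
        by (auto simp: separated_def dest: reachable_in_verts)
      moreover have "u \<in> ?S" using uv by simp
      ultimately show ?thesis using r uv by blast
    qed
    then show "conn G" using r conn by blast
  qed
qed

lemma induced_simps [simp]:
  "pverts (induced G S) = S" "parcs (induced G S) = parcs G \<inter> S \<times> S"
  by (simp_all add: induced_def)

lemma glue_simps [simp]:
  "pverts (glue G H) = pverts G \<union> pverts H" "parcs (glue G H) = parcs G \<union> parcs H"
  by (simp_all add: glue_def)

lemma pair_graph_induced: "pair_graph G \<Longrightarrow> S \<subseteq> pverts G \<Longrightarrow> pair_graph (induced G S)"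
  by (auto simp: pair_graph_iff sym_def irrefl_def intro: finite_subset)

lemma pair_graph_glue: "pair_graph G \<Longrightarrow> pair_graph H \<Longrightarrow> pair_graph (glue G H)"
  by (auto simp: pair_graph_iff sym_def irrefl_def)

lemma induced_induced: "T \<subseteq> S \<Longrightarrow> induced (induced G S) T = induced G T"
  by (auto simp: induced_def)

lemma separated_glue:
  "pair_graph G \<Longrightarrow> pair_graph H \<Longrightarrow> pverts G \<inter> pverts H = {} \<Longrightarrow> separated (glue G H) (pverts G)"
  by (auto simp: separated_def pair_graph_iff)

lemma induced_glue:
  assumes "pair_graph G" "pair_graph H" "pverts G \<inter> pverts H = {}"
  shows "induced (glue G H) (pverts G) = G" "induced (glue G H) (pverts H) = H"
proof -
  have "parcs G \<subseteq> pverts G \<times> pverts G" "parcs H \<subseteq> pverts H \<times> pverts H"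
    using assms by (auto simp: pair_graph_iff)
  then show "induced (glue G H) (pverts G) = G" "induced (glue G H) (pverts H) = H"
    using assms(3) by (auto 0 3 intro!: pair_pre_digraph.equality dest: subsetD)
qed

lemma glue_induced:
  assumes "pair_graph G" "separated G S"
  shows "glue (induced G S) (induced G (pverts G - S)) = G"
  using assms by (auto simp: pair_graph_iff separated_def intro!: pair_pre_digraph.equality)

lemma separated_Diff: "pair_graph G \<Longrightarrow> separated G S \<Longrightarrow> separated G (pverts G - S)"
  by (auto simp: separated_def pair_graph_iff)

lemma separated_subset: "separated G S \<Longrightarrow> S \<subseteq> pverts G"
  by (simp add: separated_def)

lemma separated_Int: "separated G S \<Longrightarrow> separated G T \<Longrightarrow> separated G (S \<inter> T)"
  by (auto simp: separated_def)

lemma separated_inducedI: "separated G S \<Longrightarrow> S \<subseteq> T \<Longrightarrow> separated (induced G T) S"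
  by (auto simp: separated_def)

lemma separated_inducedD: "separated (induced G T) S \<Longrightarrow> separated G T \<Longrightarrow> separated G S"
  by (fastforce simp: separated_def)

definition components :: "'a pair_pre_digraph \<Rightarrow> 'a set set" where
  "components G = {S. separated G S \<and> conn (induced G S)}"

lemma components_subset: "S \<in> components G \<Longrightarrow> S \<subseteq> pverts G"
  by (auto simp: components_def separated_def)

lemma finite_components: "pair_graph G \<Longrightarrow> finite (components G)"
  by (rule finite_subset[of _ "Pow (pverts G)"])
    (auto dest: components_subset pair_graph_finite)

lemma component_ne: 
  assumes "pair_graph G" "S \<in> components G" shows "S \<noteq> {}"
  using assms conn_iff_separated[of "induced G S"] pair_graph_induced[of G S]
  by (auto simp: components_def separated_def)

lemma component_separated_cases:
  assumes "pair_graph G" "S \<in> components G" "separated G T"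
  shows "S \<subseteq> T \<or> S \<inter> T = {}"
proof -
  have "separated G S" "conn (induced G S)" using assms by (auto simp: components_def)
  moreover have "separated (induced G S) (S \<inter> T)"
    by (intro separated_inducedI separated_Int) (use assms calculation in auto)
  ultimately show ?thesis
    using conn_iff_separated[OF pair_graph_induced[OF assms(1) separated_subset]] by fastforce
qed

lemma component_unique:
  assumes "pair_graph G" "S \<in> components G" "T \<in> components G" "v \<in> S" "v \<in> T"
  shows "S = T"
  using component_separated_cases[OF assms(1,2), of T] component_separated_cases[OF assms(1,3), of S] assms
  by (auto simp: components_def)

text \<open>The component of \<open>v\<close> is the least separated set containing \<open>v\<close>: a proper
  separated part of it, or its complement inside it, would be a smaller separated set through \<open>v\<close>.\<close>

lemma component_exists:
  assumes G: "pair_graph G" and v: "v \<in> pverts G"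
  obtains S where "S \<in> components G" "v \<in> S"
proof -
  define S where "S = \<Inter>{S. separated G S \<and> v \<in> S}"
  have all: "separated G (pverts G)" using G by (auto simp: separated_def pair_graph_iff)
  have S: "separated G S"
  proof -
    have "S \<subseteq> pverts G" unfolding S_def using all v by blast
    moreover have "x \<in> S \<longleftrightarrow> y \<in> S" if "(x, y) \<in> parcs G" for x y
      unfolding S_def using that by (simp add: separated_def) blast
    ultimately show ?thesis by (auto simp: separated_def)
  qed
  have vS: "v \<in> S" and least: "S \<subseteq> T" if "separated G T" "v \<in> T" for T
    using that by (auto simp: S_def)
  note vS = vS[OF all v]
  have "T = {} \<or> T = S" if "separated (induced G S) T" for T
  proof -
    have sub: "T \<subseteq> S" using that by (simp add: separated_def)
    have T: "separated G T" using separated_inducedD[OF that S] .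
    have "separated G (S \<inter> (pverts G - T))" using separated_Int[OF S separated_Diff[OF G T]] .
    then have "S \<subseteq> S \<inter> (pverts G - T)" if "v \<notin> T" using that vS v by (intro least) auto
    then show ?thesis using least[OF T] sub by blast
  qed
  moreover have "pverts (induced G S) \<noteq> {}" using vS by auto
  ultimately have "conn (induced G S)"
    using conn_iff_separated[OF pair_graph_induced[OF G separated_subset[OF S]]]
    by (metis induced_simps(1))
  with S vS show ?thesis by (intro that[of S]) (auto simp: components_def)
qed

lemma components_separated:
  assumes "pair_graph G" "separated G S"
  shows "components G = components (induced G S) \<union> components (induced G (pverts G - S))"
    and "components (induced G S) \<inter> components (induced G (pverts G - S)) = {}"
proof -
  have sub: "components (induced G T) = {U \<in> components G. U \<subseteq> T}" if "separated G T" for T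
  proof (rule set_eqI)
    fix U
    show "U \<in> components (induced G T) \<longleftrightarrow> U \<in> {U \<in> components G. U \<subseteq> T}"
      using separated_subset[of "induced G T" U] separated_inducedI[of G U T] separated_inducedD[OF _ that, of U]
        induced_induced[of U T G]
      by (auto simp: components_def)
  qed
  note 1 = sub[OF assms(2)] sub[OF separated_Diff[OF assms]]
  show "components G = components (induced G S) \<union> components (induced G (pverts G - S))"
  proof (rule set_eqI)
    fix U
    show "U \<in> components G \<longleftrightarrow> U \<in> components (induced G S) \<union> components (induced G (pverts G - S))"
      unfolding 1 using component_separated_cases[OF assms(1) _ assms(2), of U] components_subset[of U G] by auto
  qed
  show "components (induced G S) \<inter> components (induced G (pverts G - S)) = {}"
  proof -
    have False if "U \<subseteq> S" "U \<subseteq> pverts G - S" "U \<in> components G" for U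
      using that component_ne[OF assms(1), of U] by auto
    then show ?thesis unfolding 1 by auto
  qed
qed

lemma components_conn: "pair_graph G \<Longrightarrow> conn G \<Longrightarrow> components G = {pverts G}"
proof -
  assume a: "pair_graph G" "conn G"
  have i: "induced G (pverts G) = G" using a by (auto simp: pair_graph_iff intro!: pair_pre_digraph.equality)
  have "pverts G \<in> components G"
    using a i by (auto simp: components_def separated_def pair_graph_verts)
  then show ?thesis
    using component_ne[OF a(1)] conn_iff_separated[OF a(1)] a(2) by (auto simp: components_def)
qed

lemma components_empty_iff: "pair_graph G \<Longrightarrow> components G = {} \<longleftrightarrow> pverts G = {}"
  using component_exists component_ne components_subset by (metis empty_iff equals0I subset_empty)

section \<open>Relabelling and isomorphism\<close>

definition relabel :: "('a \<Rightarrow> 'b) \<Rightarrow> 'a pair_pre_digraph \<Rightarrow> 'b pair_pre_digraph" where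
  "relabel f G = \<lparr> pverts = f ` pverts G, parcs = map_prod f f ` parcs G \<rparr>"

text \<open>Isomorphism as an explicit relabelling, so that a property is invariant as soon as it survives
  \<open>relabel f\<close>, and so that the vertex types may differ.\<close>

definition graph_iso :: "'a pair_pre_digraph \<Rightarrow> 'b pair_pre_digraph \<Rightarrow> bool" where
  "graph_iso G H \<longleftrightarrow> (\<exists>f. inj_on f (pverts G) \<and> H = relabel f G)"

lemma relabel_simps [simp]:
  "pverts (relabel f G) = f ` pverts G" "parcs (relabel f G) = map_prod f f ` parcs G"
  by (simp_all add: relabel_def)

lemma relabel_arc_iff:
  assumes "pair_graph G" "inj_on f (pverts G)" "u \<in> pverts G" "v \<in> pverts G"
  shows "(f u, f v) \<in> parcs (relabel f G) \<longleftrightarrow> (u, v) \<in> parcs G"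
proof
  assume "(f u, f v) \<in> parcs (relabel f G)"
  then obtain x y where xy: "(x, y) \<in> parcs G" "f u = f x" "f v = f y" by auto
  then have "x = u" "y = v"
    using assms pair_graph_verts[OF assms(1) xy(1)] by (auto dest: inj_onD)
  with xy show "(u, v) \<in> parcs G" by simp
qed force

lemma pair_graph_relabel: "pair_graph G \<Longrightarrow> inj_on f (pverts G) \<Longrightarrow> pair_graph (relabel f G)"
  by (auto simp: pair_graph_iff sym_def irrefl_def dest: inj_onD) 

lemma relabel_relabel: "relabel g (relabel f G) = relabel (g \<circ> f) G"
  by (auto simp: relabel_def image_image map_prod_def split_def)

lemma relabel_cong:
  assumes "pair_graph G" "\<And>v. v \<in> pverts G \<Longrightarrow> f v = g v"
  shows "relabel f G = relabel g G"
proof -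
  have "map_prod f f e = map_prod g g e" if "e \<in> parcs G" for e
    using that assms by (cases e) (auto simp: pair_graph_iff)
  then show ?thesis using assms by (simp add: relabel_def cong: image_cong)
qed

lemma relabel_id: "relabel id G = G"
  by (auto intro!: pair_pre_digraph.equality simp: prod.map_id0)

lemma relabel_inv_into:
  assumes "pair_graph G" "inj_on f (pverts G)"
  shows "relabel (inv_into (pverts G) f) (relabel f G) = G"
proof -
  have "relabel (inv_into (pverts G) f \<circ> f) G = relabel id G"
    by (rule relabel_cong) (use assms in auto)
  then show ?thesis by (simp add: relabel_relabel relabel_id)
qed

lemma graph_iso_refl: "graph_iso G G" 
  unfolding graph_iso_def by (intro exI[of _ id]) (simp add: relabel_id)

lemma graph_iso_card: "graph_iso G H \<Longrightarrow> card (pverts H) = card (pverts G)"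
  by (auto simp: graph_iso_def card_image)

lemma graph_iso_pair_graph: "graph_iso G H \<Longrightarrow> pair_graph G \<Longrightarrow> pair_graph H"
  by (auto simp: graph_iso_def pair_graph_relabel)

lemma graph_iso_iff_digraph_iso:
  assumes "pair_graph G" "pair_graph H"
  shows "digraph_iso (with_proj G) (with_proj H) \<longleftrightarrow> graph_iso G H"
  unfolding digraph_iso_with_proj_iff[OF assms]
proof
  assume "graph_iso G H"
  then obtain f where f: "inj_on f (pverts G)" "H = relabel f G" by (auto simp: graph_iso_def)
  then show "\<exists>f. bij_betw f (pverts G) (pverts H) \<and> (\<forall>u\<in>pverts G. \<forall>v\<in>pverts G. ((u, v) \<in> parcs G) = ((f u, f v) \<in> parcs H))"
    using relabel_arc_iff[OF assms(1), of f]
    by (intro exI[of _ f]) (auto simp: bij_betw_def simp del: relabel_simps(2))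
next
  assume "\<exists>f. bij_betw f (pverts G) (pverts H) \<and> (\<forall>u\<in>pverts G. \<forall>v\<in>pverts G. ((u, v) \<in> parcs G) = ((f u, f v) \<in> parcs H))"
  then obtain f where f: "inj_on f (pverts G)" "f ` pverts G = pverts H" 
    "\<And>u v. u\<in>pverts G \<Longrightarrow> v\<in>pverts G \<Longrightarrow> ((u, v) \<in> parcs G) = ((f u, f v) \<in> parcs H)"
    by (auto simp: bij_betw_def)
  have "parcs H = map_prod f f ` parcs G"
  proof
    show "parcs H \<subseteq> map_prod f f ` parcs G"
    proof
      fix p assume p: "p \<in> parcs H"
      then obtain x y where "x \<in> pverts G" "y \<in> pverts G" "p = (f x, f y)"
        using pair_graph_verts[OF assms(2), of "fst p" "snd p"] f(2)
        by (metis imageE prod.collapse)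
      with p f(3) show "p \<in> map_prod f f ` parcs G" by force
    qed
    show "map_prod f f ` parcs G \<subseteq> parcs H"
    proof
      fix p assume "p \<in> map_prod f f ` parcs G"
      then obtain x y where "(x, y) \<in> parcs G" "p = (f x, f y)" by auto
      then show "p \<in> parcs H" using f(3)[of x y] pair_graph_verts[OF assms(1)] by simp
    qed
  qed
  then show "graph_iso G H" using f unfolding graph_iso_def
    by (intro exI[of _ f]) (simp add: pair_pre_digraph.equality)
qed

lemma graph_iso_glue:
  assumes G: "pair_graph G" "pair_graph G'" and d: "pverts G \<inter> pverts G' = {}" "pverts H \<inter> pverts H' = {}"
    and "graph_iso G H" "graph_iso G' H'"
  shows "graph_iso (glue G G') (glue H H')"
proof -
  obtain f g where f: "inj_on f (pverts G)" "H = relabel f G" and g: "inj_on g (pverts G')" "H' = relabel g G'"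
    using assms by (auto simp: graph_iso_def)
  let ?h = "\<lambda>v. if v \<in> pverts G then f v else g v"
  have 1: "relabel ?h G = relabel f G" by (rule relabel_cong) (use G in auto)
  have 2: "relabel ?h G' = relabel g G'" by (rule relabel_cong) (use G d in auto)
  have "relabel h (glue G G') = glue (relabel h G) (relabel h G')" for h :: "'a \<Rightarrow> 'b"
    by (simp only: relabel_def glue_def image_Un pair_pre_digraph.simps)
  then have "relabel ?h (glue G G') = glue H H'" using 1 2 f g by simp
  moreover have "inj_on ?h (pverts (glue G G'))"
    using f g d by (fastforce simp: inj_on_def)
  ultimately show ?thesis unfolding graph_iso_def by metis
qed

lemma relabel_induced:
  assumes "pair_graph G" "inj_on f (pverts G)" "S \<subseteq> pverts G"
  shows "relabel f (induced G S) = induced (relabel f G) (f ` S)"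
proof -
  have "map_prod f f ` (parcs G \<inter> S \<times> S) = map_prod f f ` parcs G \<inter> f ` S \<times> f ` S" (is "?L = ?R")
  proof
    show "?R \<subseteq> ?L"
    proof
      fix p assume "p \<in> ?R"
      then obtain x y where xy: "(x, y) \<in> parcs G" "p = (f x, f y)" by auto
      with \<open>p \<in> ?R\<close> have "f x \<in> f ` S" "f y \<in> f ` S" by auto
      with xy have "x \<in> S" "y \<in> S"
        using inj_on_image_mem_iff[OF assms(2) _ assms(3)] pair_graph_verts[OF assms(1) xy(1)] by auto
      with xy show "p \<in> ?L" by force
    qed
  qed auto
  then show ?thesis by (simp add: relabel_def induced_def)
qed

lemma separated_relabel:
  assumes "pair_graph G" "inj_on f (pverts G)" "separated G S"
  shows "separated (relabel f G) (f ` S)"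
proof -
  have S: "S \<subseteq> pverts G" using assms(3) by (rule separated_subset)
  have *: "f x \<in> f ` S \<longleftrightarrow> f y \<in> f ` S" if "(x, y) \<in> parcs G" for x y
    using inj_on_image_mem_iff[OF assms(2) _ S] pair_graph_verts[OF assms(1) that] that assms(3)
    by (auto simp: separated_def)
  have "p \<in> f ` S \<longleftrightarrow> q \<in> f ` S" if "(p, q) \<in> parcs (relabel f G)" for p q
  proof -
    from that obtain x y where xy: "(x, y) \<in> parcs G" "p = f x" "q = f y" by auto
    with *[of x y] show ?thesis by simp
  qed
  then show ?thesis by (intro separatedI) (use S in \<open>simp add: image_mono\<close>, blast)
qed

lemma conn_graph_iso:
  assumes "pair_graph G" "conn G" "graph_iso G H"
  shows "conn H"
proof -
  obtain f where f: "inj_on f (pverts G)" "H = relabel f G" using assms by (auto simp: graph_iso_def)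
  let ?g = "inv_into (pverts G) f"
  have H: "pair_graph H" using f assms pair_graph_relabel by auto
  have g: "relabel ?g H = G" "inj_on ?g (pverts H)" using f assms relabel_inv_into 
    by (auto simp: inj_on_inv_into)
  have "S = {} \<or> S = pverts H" if "separated H S" for S
  proof -
    have "separated G (?g ` S)" using separated_relabel[OF H g(2) that] g by simp
    then have "?g ` S = {} \<or> ?g ` S = ?g ` pverts H" using conn_iff_separated assms g(1) by (metis relabel_simps(1))
    then show ?thesis using g(2) that by (metis image_is_empty inj_on_image_eq_iff separated_def subset_refl)
  qed
  then show ?thesis using assms conn_iff_separated[OF H] conn_iff_separated[OF assms(1)] f by auto
qed

lemma components_relabel_subset:
  assumes "pair_graph G" "inj_on f (pverts G)" "S \<in> components G"
  shows "f ` S \<in> components (relabel f G)"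
proof -
  have S: "separated G S" "conn (induced G S)" "S \<subseteq> pverts G" using assms by (auto simp: components_def separated_def)
  have "graph_iso (induced G S) (relabel f (induced G S))" unfolding graph_iso_def
    using inj_on_subset[OF assms(2) S(3)] by auto
  then have "conn (relabel f (induced G S))"
    using conn_graph_iso[OF pair_graph_induced[OF assms(1) S(3)] S(2)] by blast
  then show ?thesis
    using separated_relabel[OF assms(1,2) S(1)] relabel_induced[OF assms(1,2) S(3)] by (simp add: components_def)
qed

lemma components_relabel:
  assumes "pair_graph G" "inj_on f (pverts G)"
  shows "components (relabel f G) = image f ` components G"
proof
  show "image f ` components G \<subseteq> components (relabel f G)"
    using components_relabel_subset[OF assms] by auto
  let ?g = "inv_into (pverts G) f"
  show "components (relabel f G) \<subseteq> image f ` components G"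
  proof
    fix T assume T: "T \<in> components (relabel f G)"
    have "?g ` T \<in> components (relabel ?g (relabel f G))"
      using assms by (intro components_relabel_subset T pair_graph_relabel) (auto simp: inj_on_inv_into)
    then have "?g ` T \<in> components G" using relabel_inv_into[OF assms] by simp
    moreover have "T \<subseteq> f ` pverts G" using components_subset[OF T] by simp
    then have "f ` ?g ` T = T" by (rule image_inv_into_cancel[OF refl])
    ultimately show "T \<in> image f ` components G" by (metis imageI)
  qed
qed

section \<open>The multiset of component classes\<close>

lemma inj_on_image_components: "inj_on f (pverts G) \<Longrightarrow> inj_on (image f) (components G)"
  using components_subset inj_on_image_eq_iff by (metis inj_onI)

definition iso_class :: "nat pair_pre_digraph \<Rightarrow> nat pair_pre_digraph set" where
  "iso_class G = graph_iso_rel `` {G}"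

lemma iso_class_eq_iff: "pair_graph G \<Longrightarrow> pair_graph H \<Longrightarrow> iso_class G = iso_class H \<longleftrightarrow> graph_iso G H"
  using eq_equiv_class_iff[OF equiv_graph_iso_rel, of G H] graph_iso_iff_digraph_iso[of G H]
  by (simp add: iso_class_def graph_iso_rel_def)

lemma mem_iso_class: "pair_graph G \<Longrightarrow> H \<in> iso_class G \<longleftrightarrow> pair_graph H \<and> graph_iso G H"
  using graph_iso_iff_digraph_iso[of G H] by (auto simp: iso_class_def graph_iso_rel_def)

lemma unlabeled_graphs_eq: "unlabeled_graphs n P = iso_class ` {G. pair_graph G \<and> card (pverts G) = n \<and> P G}"
  by (auto simp: unlabeled_graphs_def quotient_def iso_class_def)

definition component_classes :: "nat pair_pre_digraph \<Rightarrow> nat pair_pre_digraph set multiset" where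
  "component_classes G = image_mset (\<lambda>S. iso_class (induced G S)) (mset_set (components G))"

lemma component_classes_separated:
  assumes "pair_graph G" "separated G S"
  shows "component_classes G = component_classes (induced G S) + component_classes (induced G (pverts G - S))"
proof -
  have fin: "finite (components (induced G T))" if "T \<subseteq> pverts G" for T
    using finite_components[OF pair_graph_induced[OF assms(1) that]] .
  have eq: "component_classes (induced G T) = image_mset (\<lambda>S. iso_class (induced G S)) (mset_set (components (induced G T)))" 
    if "T \<subseteq> pverts G" for T
    unfolding component_classes_def
    by (rule image_mset_cong) (use that components_subset fin in \<open>force simp: induced_induced\<close>)
  have "S \<subseteq> pverts G" using assms by (simp add: separated_def)
  then show ?thesis
    unfolding eq[OF \<open>S \<subseteq> pverts G\<close>] eq[OF Diff_subset]
    by (simp add: component_classes_def components_separated[OF assms] mset_set_Union fin)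
qed

lemma induced_self: "pair_graph G \<Longrightarrow> induced G (pverts G) = G"
  by (auto simp: pair_graph_iff intro!: pair_pre_digraph.equality)

lemma component_classes_conn: "pair_graph G \<Longrightarrow> conn G \<Longrightarrow> component_classes G = {#iso_class G#}"
  by (simp add: component_classes_def components_conn induced_self)

lemma component_classes_empty: "pair_graph G \<Longrightarrow> component_classes G = {#} \<longleftrightarrow> pverts G = {}"
  using finite_components[of G] components_empty_iff[of G] 
  by (simp add: component_classes_def mset_set_empty_iff)

lemma component_classes_glue:
  assumes "pair_graph G" "pair_graph H" "pverts G \<inter> pverts H = {}"
  shows "component_classes (glue G H) = component_classes G + component_classes H"
proof -
  have "pverts (glue G H) - pverts G = pverts H" using assms by auto
  then show ?thesis
    using component_classes_separated[OF pair_graph_glue separated_glue, OF assms(1,2) assms] induced_glue[OF assms] by simp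
qed

lemma component_classes_graph_iso:
  assumes "pair_graph G" "graph_iso G H"
  shows "component_classes H = component_classes G"
proof -
  obtain f where f: "inj_on f (pverts G)" "H = relabel f G" using assms by (auto simp: graph_iso_def)
  have "iso_class (induced H (f ` S)) = iso_class (induced G S)" if "S \<in> components G" for S
  proof -
    have S: "S \<subseteq> pverts G" using components_subset that by blast
    have "graph_iso (induced G S) (induced H (f ` S))"
      unfolding graph_iso_def f(2) using relabel_induced[OF assms(1) f(1) S] inj_on_subset[OF f(1) S] 
      by (intro exI[of _ f]) simp
    then show ?thesis
      using iso_class_eq_iff graph_iso_pair_graph pair_graph_induced[OF assms(1) S] by metis
  qed
  moreover have "mset_set (components H) = image_mset (image f) (mset_set (components G))"
    unfolding f(2) components_relabel[OF assms(1) f(1)]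
    by (rule image_mset_mset_set[symmetric]) (rule inj_on_image_components[OF f(1)])
  ultimately show ?thesis
    using finite_components[OF assms(1)]
    by (auto simp: component_classes_def multiset.map_comp o_def intro!: image_mset_cong)
qed

lemma component_classes_add_mset:
  assumes G: "pair_graph G" and "component_classes G = add_mset K M"
  obtains S where "S \<in> components G" "iso_class (induced G S) = K" "component_classes (induced G (pverts G - S)) = M"
proof -
  have "K \<in># component_classes G" using assms by simp
  then obtain S where S: "S \<in> components G" "iso_class (induced G S) = K"
    using finite_components[OF G] by (auto simp: component_classes_def)
  then have sep: "separated G S" "conn (induced G S)" "S \<subseteq> pverts G" by (auto simp: components_def separated_def)
  then have "component_classes (induced G S) = {#K#}" using component_classes_conn[OF pair_graph_induced[OF G sep(3)]] S by simp
  then have "component_classes (induced G (pverts G - S)) = M" using component_classes_separated[OF G sep(1)] assms by simp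
  then show ?thesis using that S by blast
qed

text \<open>A graph is determined up to isomorphism by the multiset of its component classes: a common class
  is realised by a component on either side, and these two components can be split off together.\<close>

lemma component_classes_eq_imp_graph_iso:
  assumes "pair_graph G" "pair_graph H" "component_classes G = component_classes H"
  shows "graph_iso G H"
  using assms
proof (induction "component_classes G" arbitrary: G H)
  case empty
  then have "pverts G = {}" "pverts H = {}" using component_classes_empty by metis+
  then have "G = H" using empty by (auto simp: pair_graph_iff intro!: pair_pre_digraph.equality)
  then show ?case by (simp add: graph_iso_refl)
next
  case (add K M)
  note GH = add.prems(1,2)
  obtain S where S: "S \<in> components G" "iso_class (induced G S) = K" "component_classes (induced G (pverts G - S)) = M"
    using component_classes_add_mset[OF GH(1) add.hyps(2)[symmetric]] .
  obtain T where T: "T \<in> components H" "iso_class (induced H T) = K" "component_classes (induced H (pverts H - T)) = M"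
    using component_classes_add_mset[OF GH(2), of K M] add.hyps(2) add.prems(3) by metis
  have sep: "separated G S" "separated H T" using S T by (auto simp: components_def)
  note pg = pair_graph_induced[OF GH(1) separated_subset[OF sep(1)]]
    pair_graph_induced[OF GH(2) separated_subset[OF sep(2)]]
    pair_graph_induced[OF GH(1) Diff_subset[of _ S]] pair_graph_induced[OF GH(2) Diff_subset[of _ T]]
  have "graph_iso (induced G S) (induced H T)" using iso_class_eq_iff[OF pg(1,2)] S T by simp
  moreover have "graph_iso (induced G (pverts G - S)) (induced H (pverts H - T))"
    using add.hyps(1)[OF _ pg(3,4)] S(3) T(3) by simp
  ultimately have "graph_iso (glue (induced G S) (induced G (pverts G - S))) (glue (induced H T) (induced H (pverts H - T)))"
    by (intro graph_iso_glue pg) auto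
  then show ?case using glue_induced GH sep by metis
qed

lemma component_classes_eq_iff: "pair_graph G \<Longrightarrow> pair_graph H \<Longrightarrow> component_classes G = component_classes H \<longleftrightarrow> iso_class G = iso_class H"
  using component_classes_eq_imp_graph_iso component_classes_graph_iso iso_class_eq_iff by metis

text \<open>Meaningful on isomorphism classes, all of whose members have the same number of vertices.\<close>

definition graph_order :: "nat pair_pre_digraph set \<Rightarrow> nat" where
  "graph_order K = card (pverts (SOME G. G \<in> K))"

lemma graph_order_iso_class:
  assumes "pair_graph G" shows "graph_order (iso_class G) = card (pverts G)"
proof -
  have "G \<in> iso_class G" using mem_iso_class[OF assms] assms graph_iso_refl by blast
  then have "(SOME H. H \<in> iso_class G) \<in> iso_class G" by (rule someI)
  then show ?thesis unfolding graph_order_def using mem_iso_class[OF assms] graph_iso_card by metis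
qed

lemma sum_graph_order_component_classes:
  assumes G: "pair_graph G" shows "(\<Sum>K\<in>#component_classes G. graph_order K) = card (pverts G)"
proof -
  have "(\<Sum>K\<in>#component_classes G. graph_order K) = (\<Sum>S\<in>components G. graph_order (iso_class (induced G S)))"
    by (simp add: component_classes_def sum_unfold_sum_mset multiset.map_comp o_def)
  also have "\<dots> = (\<Sum>S\<in>components G. card S)"
  proof (rule sum.cong)
    fix S assume "S \<in> components G"
    then show "graph_order (iso_class (induced G S)) = card S"
      using graph_order_iso_class[OF pair_graph_induced[OF G components_subset]] by simp
  qed simp
  also have "\<dots> = card (\<Union>(components G))"
  proof (rule card_Union_disjoint[symmetric])
    show "pairwise disjnt (components G)"
      using component_unique[OF G] by (auto simp: pairwise_def disjnt_iff)
    show "finite S" if "S \<in> components G" for S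
      using that components_subset finite_subset pair_graph_finite[OF G] by metis
  qed
  also have "\<Union>(components G) = pverts G"
    using component_exists[OF G] components_subset by (metis UnionI Union_least subsetI subset_antisym)
  finally show ?thesis .
qed

text \<open>Translating the vertex numbers makes room for disjoint unions.\<close>

lemma graph_iso_disjoint:
  fixes G H :: "nat pair_pre_digraph"
  assumes "pair_graph G" "pair_graph H"
  obtains H' where "graph_iso H H'" "pair_graph H'" "pverts G \<inter> pverts H' = {}"
proof -
  obtain k where k: "\<forall>v\<in>pverts G. v < k"
    using pair_graph_finite[OF assms(1)] finite_nat_set_iff_bounded by blast
  have "graph_iso H (relabel ((+) k) H)" unfolding graph_iso_def by (intro exI[of _ "(+) k"]) simp
  moreover from this have "pair_graph (relabel ((+) k) H)" using graph_iso_pair_graph assms by blast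
  moreover have "pverts G \<inter> pverts (relabel ((+) k) H) = {}" using k by fastforce
  ultimately show ?thesis using that by blast
qed

definition graphs_on :: "'a set \<Rightarrow> ('a pair_pre_digraph \<Rightarrow> bool) \<Rightarrow> 'a pair_pre_digraph set" where
  "graphs_on V P = {G. pair_graph G \<and> pverts G = V \<and> P G}"

lemma finite_graphs_on: 
  assumes "finite V" shows "finite (graphs_on V P)"
proof (rule finite_subset)
  show "graphs_on V P \<subseteq> (\<lambda>E. \<lparr>pverts = V, parcs = E\<rparr>) ` Pow (V \<times> V)"
    by (auto simp: graphs_on_def pair_graph_iff intro!: image_eqI[where x = "parcs _"] pair_pre_digraph.equality)
qed (use assms in simp)

lemma graph_iso_onto:
  assumes "pair_graph G" "finite V" "card V = card (pverts G)"
  obtains H where "graph_iso G H" "pverts H = V"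
proof -
  obtain f where "bij_betw f (pverts G) V"
    using finite_same_card_bij[of "pverts G" V] pair_graph_finite assms by metis
  then show ?thesis using that[of "relabel f G"] by (auto simp: graph_iso_def bij_betw_def)
qed

lemma finite_unlabeled_graphs: "finite (unlabeled_graphs n P)"
proof (rule finite_subset)
  show "unlabeled_graphs n P \<subseteq> iso_class ` graphs_on {1..n} (\<lambda>_. True)"
  proof
    fix K assume "K \<in> unlabeled_graphs n P"
    then obtain G where G: "pair_graph G" "card (pverts G) = n" "K = iso_class G" by (auto simp: unlabeled_graphs_eq)
    obtain H where H: "graph_iso G H" "pverts H = {1..n}" using graph_iso_onto[OF G(1), of "{1..n}"] G(2) by auto
    then have "pair_graph H" using graph_iso_pair_graph G by blast
    then have "K = iso_class H" "H \<in> graphs_on {1..n} (\<lambda>_. True)"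
      using H G iso_class_eq_iff by (auto simp: graphs_on_def)
    then show "K \<in> iso_class ` graphs_on {1..n} (\<lambda>_. True)" by (rule image_eqI)
  qed
qed (simp add: finite_graphs_on)

section \<open>Multisets of given weight\<close>

definition weighted_msets :: "('b \<Rightarrow> nat) \<Rightarrow> 'b set \<Rightarrow> nat \<Rightarrow> 'b multiset set" where
  "weighted_msets w S n = {M. set_mset M \<subseteq> S \<and> (\<Sum>x\<in>#M. w x) = n}"

lemma weighted_msets_mono: "S \<subseteq> T \<Longrightarrow> weighted_msets w S n \<subseteq> weighted_msets w T n"
  by (auto simp: weighted_msets_def)

lemma card_weighted_msets_remove:
  assumes "K \<in> S" and fin: "finite (weighted_msets w S n)"
  shows "card (weighted_msets w S n) =
    card (weighted_msets w (S - {K}) n) + (if w K \<le> n then card (weighted_msets w S (n - w K)) else 0)"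
proof -
  let ?A = "weighted_msets w (S - {K}) n"
  let ?B = "if w K \<le> n then add_mset K ` weighted_msets w S (n - w K) else {}"
  have eq: "weighted_msets w S n = ?A \<union> ?B"
  proof (rule set_eqI)
    fix M
    show "M \<in> weighted_msets w S n \<longleftrightarrow> M \<in> ?A \<union> ?B"
    proof (cases "K \<in># M")
      case True
      then obtain M' where M: "M = add_mset K M'" by (metis mset_add)
      have "M \<in> ?B \<longleftrightarrow> w K \<le> n \<and> M' \<in> weighted_msets w S (n - w K)"
        by (auto simp: M)
      moreover have "M \<in> weighted_msets w S n \<longleftrightarrow> w K \<le> n \<and> M' \<in> weighted_msets w S (n - w K)"
        using assms(1) by (auto simp: M weighted_msets_def)
      moreover have "M \<notin> ?A" using True by (auto simp: weighted_msets_def)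
      ultimately show ?thesis by simp
    next
      case False
      then show ?thesis by (auto simp: weighted_msets_def)
    qed
  qed
  have "K \<notin># M" if "M \<in> ?A" for M using that by (auto simp: weighted_msets_def)
  moreover have "K \<in># M" if "M \<in> ?B" for M using that by (auto split: if_splits)
  ultimately have disj: "?A \<inter> ?B = {}" by blast
  have "finite (?A \<union> ?B)" using fin unfolding eq .
  then have "card (weighted_msets w S n) = card ?A + card ?B"
    unfolding eq finite_Un using card_Un_disjoint[OF _ _ disj] by blast
  moreover have "inj_on (add_mset K) X" for X by (simp add: inj_on_def)
  ultimately show ?thesis by (simp add: card_image)
qed

lemma card_weighted_msets_bij:
  assumes f: "bij_betw f S T" and w: "\<And>s. s \<in> S \<Longrightarrow> w (f s) = w s"
  shows "card (weighted_msets w S n) = card (weighted_msets w T n)"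
proof (rule bij_betw_same_card)
  let ?g = "inv_into S f"
  have g: "\<And>t. t \<in> T \<Longrightarrow> ?g t \<in> S" "\<And>t. t \<in> T \<Longrightarrow> f (?g t) = t" "\<And>s. s \<in> S \<Longrightarrow> ?g (f s) = s" "f ` S = T"
    using f bij_betw_inv_into_left bij_betw_inv_into_right
    by (auto simp: bij_betw_def inv_into_into)
  have wg: "w (?g t) = w t" if "t \<in> T" for t using w[OF g(1)[OF that]] g(2)[OF that] by simp
  show "bij_betw (image_mset f) (weighted_msets w S n) (weighted_msets w T n)"
  proof (rule bij_betw_byWitness[where f' = "image_mset ?g"])
    show "\<forall>M\<in>weighted_msets w S n. image_mset ?g (image_mset f M) = M"
    proof
      fix M assume "M \<in> weighted_msets w S n"
      then have "image_mset (\<lambda>x. ?g (f x)) M = image_mset (\<lambda>x. x) M"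
        by (intro image_mset_cong g) (auto simp: weighted_msets_def)
      then show "image_mset ?g (image_mset f M) = M" by (simp add: multiset.map_comp o_def)
    qed
    show "\<forall>M\<in>weighted_msets w T n. image_mset f (image_mset ?g M) = M"
    proof
      fix M assume "M \<in> weighted_msets w T n"
      then have "image_mset (\<lambda>x. f (?g x)) M = image_mset (\<lambda>x. x) M"
        by (intro image_mset_cong g) (auto simp: weighted_msets_def)
      then show "image_mset f (image_mset ?g M) = M" by (simp add: multiset.map_comp o_def)
    qed
    have "image_mset f M \<in> weighted_msets w T n" if "M \<in> weighted_msets w S n" for M
    proof -
      have "image_mset (\<lambda>x. w (f x)) M = image_mset w M"
        using that by (intro image_mset_cong w) (auto simp: weighted_msets_def)
      with that g(4) show ?thesis by (auto simp: weighted_msets_def multiset.map_comp o_def)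
    qed
    then show "image_mset f ` weighted_msets w S n \<subseteq> weighted_msets w T n" by blast
    have "image_mset ?g M \<in> weighted_msets w S n" if "M \<in> weighted_msets w T n" for M
    proof -
      have "image_mset (\<lambda>x. w (?g x)) M = image_mset w M"
        using that by (intro image_mset_cong wg) (auto simp: weighted_msets_def)
      with that g(1) show ?thesis by (auto simp: weighted_msets_def multiset.map_comp o_def)
    qed
    then show "image_mset ?g ` weighted_msets w T n \<subseteq> weighted_msets w S n" by blast
  qed
qed

text \<open>Since weights are positive, a multiset of weight \<open>n\<close> containing an element of weight at
  least \<open>n\<close> is that element alone.\<close>

lemma card_weighted_msets_split:
  assumes pos: "\<And>s. s \<in> S \<Longrightarrow> 0 < w s" and fin: "finite (weighted_msets w S n)"
  shows "card (weighted_msets w S n) = card {s \<in> S. w s = n} + card (weighted_msets w {s \<in> S. w s < n} n)"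
proof -
  let ?A = "(\<lambda>s. {#s#}) ` {s \<in> S. w s = n}" and ?B = "weighted_msets w {s \<in> S. w s < n} n"
  have eq: "weighted_msets w S n = ?A \<union> ?B"
  proof
    show "weighted_msets w S n \<subseteq> ?A \<union> ?B"
    proof
      fix M assume M: "M \<in> weighted_msets w S n"
      show "M \<in> ?A \<union> ?B"
      proof (cases "\<exists>s\<in>#M. n \<le> w s")
        case True
        then obtain s M' where s: "M = add_mset s M'" "n \<le> w s" by (metis mset_add)
        then have ws: "w s + (\<Sum>x\<in>#M'. w x) = n" and sub: "s \<in> S" "set_mset M' \<subseteq> S" 
          using M by (auto simp: weighted_msets_def)
        then have "(\<Sum>x\<in>#M'. w x) = 0" using s(2) by linarith
        then have "\<forall>x\<in>#M'. w x = 0" by (auto simp: sum_mset_0_iff)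
        then have "M' = {#}" using pos sub(2) by (metis less_irrefl multiset_nonemptyE subsetD)
        then show ?thesis using ws sub s by simp
      next
        case False
        then have "\<forall>s\<in>#M. w s < n" by (simp add: not_le)
        then show ?thesis using M by (auto simp: weighted_msets_def)
      qed
    qed
    show "?A \<union> ?B \<subseteq> weighted_msets w S n" by (auto simp: weighted_msets_def)
  qed
  have "M \<notin> ?B" if "M \<in> ?A" for M
    using that by (clarsimp simp: weighted_msets_def)
  then have disj: "?A \<inter> ?B = {}" by blast
  have "finite (?A \<union> ?B)" using fin unfolding eq .
  then have "card (weighted_msets w S n) = card ?A + card ?B"
    unfolding eq finite_Un using card_Un_disjoint[OF _ _ disj] by blast
  then show ?thesis by (simp add: card_image inj_on_def)
qed

lemma finite_weighted_atoms:
  assumes "finite (weighted_msets w S n)" shows "finite {s \<in> S. w s = n}"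
proof -
  have "(\<lambda>s. {#s#}) ` {s \<in> S. w s = n} \<subseteq> weighted_msets w S n"
    by (auto simp: weighted_msets_def)
  then have "finite ((\<lambda>s. {#s#}) ` {s \<in> S. w s = n})" using assms finite_subset by blast
  then show ?thesis by (rule finite_imageD) (simp add: inj_on_def)
qed

text \<open>In generating functions: the exponents in \<open>\<Prod>k. (1 - x ^ k) powi (- c k)\<close> are determined
  by the product. By induction on \<open>n\<close>: when there are equally many elements of each weight below
  \<open>n\<close>, the multisets of weight \<open>n\<close> built from these are equinumerous, and what remains are the
  singletons of weight \<open>n\<close>.\<close>

lemma weighted_atoms_unique:
  assumes pos: "\<And>s. s \<in> S \<union> T \<Longrightarrow> 0 < w s"
    and fin: "\<And>n. finite (weighted_msets w S n)" "\<And>n. finite (weighted_msets w T n)"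
    and eq: "\<And>n. card (weighted_msets w S n) = card (weighted_msets w T n)"
  shows "card {s \<in> S. w s = n} = card {t \<in> T. w t = n}"
proof (induction n rule: less_induct)
  case (less n)
  have "\<exists>g. bij_betw g {s \<in> S. w s = k} {t \<in> T. w t = k}" if "k < n" for k
    using less[OF that] finite_weighted_atoms fin by (intro finite_same_card_bij) auto
  then obtain g where g: "\<And>k. k < n \<Longrightarrow> bij_betw (g k) {s \<in> S. w s = k} {t \<in> T. w t = k}" by metis
  define f where "f s = g (w s) s" for s
  have f: "f s \<in> T" "w (f s) = w s" if "s \<in> S" "w s < n" for s
    using bij_betwE[OF g[OF that(2)]] that by (auto simp: f_def)
  have "bij_betw f {s \<in> S. w s < n} {t \<in> T. w t < n}"
    unfolding bij_betw_def
  proof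
    show "inj_on f {s \<in> S. w s < n}"
    proof (rule inj_onI)
      fix x y assume xy: "x \<in> {s \<in> S. w s < n}" "y \<in> {s \<in> S. w s < n}" "f x = f y"
      then have "w x = w y" using f(2)[of x] f(2)[of y] by simp
      then show "x = y" using xy bij_betw_imp_inj_on[OF g[of "w x"]]
        by (auto simp: f_def dest: inj_onD)
    qed
    show "f ` {s \<in> S. w s < n} = {t \<in> T. w t < n}"
    proof
      show "f ` {s \<in> S. w s < n} \<subseteq> {t \<in> T. w t < n}" using f by auto
      show "{t \<in> T. w t < n} \<subseteq> f ` {s \<in> S. w s < n}"
      proof
        fix t assume t: "t \<in> {t \<in> T. w t < n}"
        then have "t \<in> g (w t) ` {s \<in> S. w s = w t}" using bij_betw_imp_surj_on[OF g[of "w t"]] by simp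
        then obtain s where "s \<in> S" "w s = w t" "t = g (w t) s" by auto
        then show "t \<in> f ` {s \<in> S. w s < n}" using t by (auto simp: f_def intro!: image_eqI[of _ _ s])
      qed
    qed
  qed
  then have "card (weighted_msets w {s \<in> S. w s < n} n) = card (weighted_msets w {t \<in> T. w t < n} n)"
    by (rule card_weighted_msets_bij) (use f in auto)
  then show ?case
    using card_weighted_msets_split[of S w n] card_weighted_msets_split[of T w n] pos fin eq[of n] by auto
qed

section \<open>Classes of graphs closed under disjoint union\<close>

definition connected_classes :: "(nat pair_pre_digraph \<Rightarrow> bool) \<Rightarrow> nat pair_pre_digraph set set" where
  "connected_classes P = iso_class ` {G. pair_graph G \<and> conn G \<and> P G}"

lemma connected_classes_of_order: "{K \<in> connected_classes P. graph_order K = n} = unlabeled_graphs n (\<lambda>G. conn G \<and> P G)"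
  unfolding connected_classes_def unlabeled_graphs_eq using graph_order_iso_class by fastforce

lemma graph_order_connected_classes_pos:
  assumes "K \<in> connected_classes P" shows "0 < graph_order K"
proof -
  obtain G where G: "pair_graph G" "conn G" "K = iso_class G" using assms by (auto simp: connected_classes_def)
  then have "pverts G \<noteq> {}" using conn_iff_separated by blast
  then show ?thesis using G graph_order_iso_class pair_graph_finite by (simp add: card_gt_0_iff)
qed

lemma card_image_cong_eq:
  assumes "\<And>x y. x \<in> A \<Longrightarrow> y \<in> A \<Longrightarrow> f x = f y \<longleftrightarrow> g x = g y"
  shows "card (f ` A) = card (g ` A)"
proof (rule bij_betw_same_card)
  have inv: "inv_into A f (f x) \<in> A" "f (inv_into A f (f x)) = f x" if "x \<in> A" for x
    using that by (auto simp: inv_into_into f_inv_into_f)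
  have g: "g (inv_into A f (f x)) = g x" if "x \<in> A" for x
    using assms[OF inv(1)[OF that] that] inv(2)[OF that] by simp
  show "bij_betw (\<lambda>y. g (inv_into A f y)) (f ` A) (g ` A)"
    unfolding bij_betw_def
  proof
    show "inj_on (\<lambda>y. g (inv_into A f y)) (f ` A)"
    proof (rule inj_onI)
      fix p q assume pq: "p \<in> f ` A" "q \<in> f ` A" "g (inv_into A f p) = g (inv_into A f q)"
      then obtain x y where "x \<in> A" "p = f x" "y \<in> A" "q = f y" by auto
      then show "p = q" using pq(3) g assms by simp
    qed
    show "(\<lambda>y. g (inv_into A f y)) ` f ` A = g ` A"
      using g by (simp add: image_image)
  qed
qed

definition iso_invariant :: "('a pair_pre_digraph \<Rightarrow> bool) \<Rightarrow> bool" where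
  "iso_invariant P \<longleftrightarrow> (\<forall>G H. pair_graph G \<longrightarrow> graph_iso G H \<longrightarrow> P G \<longrightarrow> P H)"

text \<open>The classes of graphs for which the passage from connected to arbitrary members is unrestricted:
  all disjoint unions of connected members belong to the class, and nothing else does.\<close>

locale additive_class =
  fixes X :: "nat pair_pre_digraph \<Rightarrow> bool"
  assumes X_invariant: "iso_invariant X"
    and X_separated: "pair_graph G \<Longrightarrow> separated G S \<Longrightarrow> X G \<longleftrightarrow> X (induced G S) \<and> X (induced G (pverts G - S))"
    and X_empty: "X \<lparr>pverts = {}, parcs = {}\<rparr>"
begin

lemma X_graph_iso: "pair_graph G \<Longrightarrow> graph_iso G H \<Longrightarrow> X G \<Longrightarrow> X H"
  using X_invariant unfolding iso_invariant_def by blast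

lemma X_glue:
  assumes "pair_graph G" "pair_graph H" "pverts G \<inter> pverts H = {}"
  shows "X (glue G H) \<longleftrightarrow> X G \<and> X H"
proof -
  have "pverts (glue G H) - pverts G = pverts H" using assms by auto
  then show ?thesis
    using X_separated[OF pair_graph_glue separated_glue, OF assms(1,2) assms] induced_glue[OF assms] by simp
qed

lemma component_classes_subset_connected_classes:
  assumes "pair_graph G" "X G"
  shows "set_mset (component_classes G) \<subseteq> connected_classes X"
proof
  fix K assume "K \<in># component_classes G"
  then obtain S where S: "S \<in> components G" "K = iso_class (induced G S)"
    using finite_components[OF assms(1)] by (auto simp: component_classes_def)
  then have "separated G S" "conn (induced G S)" by (auto simp: components_def)
  then have "X (induced G S)" "pair_graph (induced G S)"
    using X_separated assms pair_graph_induced separated_subset by blast+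
  then show "K \<in> connected_classes X" using S \<open>conn (induced G S)\<close> by (auto simp: connected_classes_def)
qed

lemma component_classes_glue_fresh:
  assumes "pair_graph G" "pair_graph H" "conn H"
  obtains H' where "graph_iso H H'" "pair_graph H'" "pverts G \<inter> pverts H' = {}" "component_classes (glue G H') = add_mset (iso_class H) (component_classes G)"
proof -
  obtain H' where H': "graph_iso H H'" "pair_graph H'" "pverts G \<inter> pverts H' = {}"
    using graph_iso_disjoint[OF assms(1,2)] .
  have "component_classes H' = {#iso_class H#}"
    using component_classes_conn[OF assms(2,3)] component_classes_graph_iso[OF assms(2) H'(1)] by simp
  then show ?thesis using that H' component_classes_glue[OF assms(1) H'(2,3)] by simp
qed

lemma component_classes_surj:
  "set_mset M \<subseteq> connected_classes X \<Longrightarrow> \<exists>G. pair_graph G \<and> X G \<and> component_classes G = M"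
proof (induction M)
  case empty
  have "pair_graph \<lparr>pverts = {} :: nat set, parcs = {}\<rparr>" by (simp add: pair_graph_iff sym_def irrefl_def)
  then show ?case using X_empty component_classes_empty by (metis pair_pre_digraph.select_convs(1))
next
  case (add K M)
  then obtain G where G: "pair_graph G" "X G" "component_classes G = M" by auto
  obtain H where H: "pair_graph H" "conn H" "X H" "K = iso_class H" using add.prems by (auto simp: connected_classes_def)
  obtain H' where H': "graph_iso H H'" "pair_graph H'" "pverts G \<inter> pverts H' = {}" "component_classes (glue G H') = add_mset K (component_classes G)"
    using component_classes_glue_fresh[OF G(1) H(1,2)] H(4) by metis
  have "X H'" using X_graph_iso H H' by blast
  then have "X (glue G H')" using X_glue G H' by blast
  then show ?case using pair_graph_glue[OF G(1) H'(2)] H'(4) G(3) by blast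
qed

text \<open>Unlabelled members of an additive class are exactly the multisets of connected ones.\<close>

lemma component_classes_image:
  "component_classes ` {G. pair_graph G \<and> card (pverts G) = n \<and> X G} = weighted_msets graph_order (connected_classes X) n"
proof
  show "component_classes ` {G. pair_graph G \<and> card (pverts G) = n \<and> X G} \<subseteq> weighted_msets graph_order (connected_classes X) n"
  proof (rule image_subsetI)
    fix G assume "G \<in> {G. pair_graph G \<and> card (pverts G) = n \<and> X G}"
    then show "component_classes G \<in> weighted_msets graph_order (connected_classes X) n"
      using component_classes_subset_connected_classes[of G] sum_graph_order_component_classes[of G] by (simp add: weighted_msets_def)
  qed
  show "weighted_msets graph_order (connected_classes X) n \<subseteq> component_classes ` {G. pair_graph G \<and> card (pverts G) = n \<and> X G}"
  proof
    fix M assume M: "M \<in> weighted_msets graph_order (connected_classes X) n"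
    then obtain G where G: "pair_graph G" "X G" "component_classes G = M"
      using component_classes_surj by (auto simp: weighted_msets_def)
    then have "card (pverts G) = n" using M sum_graph_order_component_classes[of G] by (simp add: weighted_msets_def)
    then show "M \<in> component_classes ` {G. pair_graph G \<and> card (pverts G) = n \<and> X G}" using G by blast
  qed
qed

end

lemma card_unlabeled_component_classes:
  "card (unlabeled_graphs n P) = card (component_classes ` {G. pair_graph G \<and> card (pverts G) = n \<and> P G})"
  unfolding unlabeled_graphs_eq by (rule card_image_cong_eq) (simp add: component_classes_eq_iff)

context additive_class begin

lemma card_unlabeled: "card (unlabeled_graphs n X) = card (weighted_msets graph_order (connected_classes X) n)"
  unfolding card_unlabeled_component_classes component_classes_image ..

text \<open>The multiset of component classes factors through the isomorphism class, and there are only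
  finitely many isomorphism classes of each order.\<close>

lemma finite_weighted_msets: "finite (weighted_msets graph_order (connected_classes X) n)"
proof -
  let ?A = "{G. pair_graph G \<and> card (pverts G) = n \<and> X G}"
  have "component_classes G = component_classes (SOME H. pair_graph H \<and> iso_class H = iso_class G)" if "G \<in> ?A" for G
    using someI[of "\<lambda>H. pair_graph H \<and> iso_class H = iso_class G" G] that component_classes_eq_iff by blast
  then have "component_classes ` ?A \<subseteq> (\<lambda>K. component_classes (SOME H. pair_graph H \<and> iso_class H = K)) ` iso_class ` ?A" by blast
  moreover have "finite (iso_class ` ?A)" using finite_unlabeled_graphs[of n X] unfolding unlabeled_graphs_eq .
  ultimately have "finite (component_classes ` ?A)" by (rule finite_surj[rotated])
  then show ?thesis unfolding component_classes_image .
qed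

end

section \<open>Labelled graphs and the component of a vertex\<close>

lemma labeled_graphs_eq: "labeled_graphs n P = graphs_on {1..n} P"
  by (simp add: labeled_graphs_def graphs_on_def)

lemma card_graphs_on_le:
  assumes inv: "iso_invariant P"
    and "finite V" "finite W" "card V = card W"
  shows "card (graphs_on V P) \<le> card (graphs_on W P)"
proof -
  obtain f where f: "inj_on f V" "f ` V = W"
    using finite_same_card_bij[OF assms(2-4)] by (auto simp: bij_betw_def)
  have "inj_on (relabel f) (graphs_on V P)"
  proof (rule inj_on_inverseI)
    fix G assume "G \<in> graphs_on V P"
    then show "relabel (inv_into V f) (relabel f G) = G"
      using relabel_inv_into[of G f] f(1) by (auto simp: graphs_on_def)
  qed
  moreover have "relabel f ` graphs_on V P \<subseteq> graphs_on W P"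
  proof (rule image_subsetI)
    fix G assume G: "G \<in> graphs_on V P"
    then have "graph_iso G (relabel f G)" "pair_graph G" "P G" "pverts G = V" using f(1) by (auto simp: graphs_on_def graph_iso_def)
    then show "relabel f G \<in> graphs_on W P"
      using inv graph_iso_pair_graph[of G "relabel f G"] f(2) by (auto simp: graphs_on_def iso_invariant_def)
  qed
  ultimately show ?thesis using finite_graphs_on[OF assms(3)] by (rule card_inj_on_le)
qed

lemma card_graphs_on:
  assumes inv: "iso_invariant P" and "finite V"
  shows "card (graphs_on V P) = card (labeled_graphs (card V) P)"
  unfolding labeled_graphs_eq
  using card_graphs_on_le[OF inv assms(2), of "{1..card V}"] card_graphs_on_le[OF inv _ assms(2), of "{1..card V}"]
  by simp

text \<open>Cutting along \<open>S\<close> and gluing back are inverse to each other.\<close>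

lemma card_graphs_on_separated:
  assumes V: "finite V" "S \<subseteq> V"
  shows "card {G. pair_graph G \<and> pverts G = V \<and> separated G S \<and> P (induced G S) \<and> R (induced G (V - S))} =
    card (graphs_on S P) * card (graphs_on (V - S) R)" (is "card ?A = _")
proof -
  have "bij_betw (\<lambda>G. (induced G S, induced G (V - S))) ?A (graphs_on S P \<times> graphs_on (V - S) R)"
  proof (rule bij_betw_byWitness[where f' = "\<lambda>(G, H). glue G H"])
    show "\<forall>G\<in>?A. (\<lambda>(G, H). glue G H) (induced G S, induced G (V - S)) = G"
      using glue_induced by auto
    show "\<forall>p\<in>graphs_on S P \<times> graphs_on (V - S) R.
      (\<lambda>G. (induced G S, induced G (V - S))) ((\<lambda>(G, H). glue G H) p) = p"
    proof
      fix p assume "p \<in> graphs_on S P \<times> graphs_on (V - S) R"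
      then obtain G H where p: "p = (G, H)" and
        GH: "pair_graph G" "pair_graph H" "pverts G = S" "pverts H = V - S" by (auto simp: graphs_on_def)
      then have "pverts G \<inter> pverts H = {}" by auto
      from induced_glue[OF GH(1,2) this] show "(\<lambda>G. (induced G S, induced G (V - S))) ((\<lambda>(G, H). glue G H) p) = p"
        using p GH by simp
    qed
    show "(\<lambda>G. (induced G S, induced G (V - S))) ` ?A \<subseteq> graphs_on S P \<times> graphs_on (V - S) R"
      using V(2) pair_graph_induced by (auto simp: graphs_on_def)
    show "(\<lambda>(G, H). glue G H) ` (graphs_on S P \<times> graphs_on (V - S) R) \<subseteq> ?A"
    proof (rule image_subsetI)
      fix p assume "p \<in> graphs_on S P \<times> graphs_on (V - S) R"
      then obtain G H where p: "p = (G, H)" and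
        GH: "pair_graph G" "pair_graph H" "pverts G = S" "pverts H = V - S" "P G" "R H" by (auto simp: graphs_on_def)
      then have d: "pverts G \<inter> pverts H = {}" by auto
      have "pverts (glue G H) = V" using GH V(2) by auto
      then show "(\<lambda>(G, H). glue G H) p \<in> ?A"
        using p GH induced_glue[OF GH(1,2) d] separated_glue[OF GH(1,2) d] pair_graph_glue[OF GH(1,2)]
        by (simp del: glue_simps)
    qed
  qed
  then show ?thesis by (simp add: bij_betw_same_card card_cartesian_product)
qed

context additive_class begin

text \<open>Classify the graphs on \<open>V\<close> by the component \<open>S\<close> of a fixed vertex \<open>v\<close>.\<close>

lemma card_graphs_on_component:
  assumes V: "finite V" "v \<in> V"
  shows "card (graphs_on V X) =
    (\<Sum>S\<in>{S. v \<in> S \<and> S \<subseteq> V}. card (graphs_on S (\<lambda>G. conn G \<and> X G)) * card (graphs_on (V - S) X))"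
proof -
  let ?A = "\<lambda>S. {G. pair_graph G \<and> pverts G = V \<and> separated G S \<and> (conn (induced G S) \<and> X (induced G S)) \<and> X (induced G (V - S))}"
  let ?I = "{S. v \<in> S \<and> S \<subseteq> V}"
  have "graphs_on V X = (\<Union>S\<in>?I. ?A S)"
  proof
    show "graphs_on V X \<subseteq> (\<Union>S\<in>?I. ?A S)"
    proof
      fix G assume "G \<in> graphs_on V X"
      then have G: "pair_graph G" "pverts G = V" "X G" by (auto simp: graphs_on_def)
      obtain S where S: "S \<in> components G" "v \<in> S" using component_exists[OF G(1)] V(2) G(2) by metis
      then have "separated G S" "conn (induced G S)" by (auto simp: components_def)
      moreover from this have "X (induced G S)" "X (induced G (V - S))" using X_separated G by blast+
      ultimately have "G \<in> ?A S" using G by blast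
      moreover have "S \<in> ?I" using S components_subset G(2) by blast
      ultimately show "G \<in> (\<Union>S\<in>?I. ?A S)" by blast
    qed
    have "G \<in> graphs_on V X" if "G \<in> ?A S" for G S using that X_separated by (auto simp: graphs_on_def)
    then show "(\<Union>S\<in>?I. ?A S) \<subseteq> graphs_on V X" by blast
  qed
  moreover have "card (\<Union>S\<in>?I. ?A S) = (\<Sum>S\<in>?I. card (?A S))"
  proof (rule card_UN_disjoint)
    show "finite ?I" using V(1) by simp
    have "?A S \<subseteq> graphs_on V (\<lambda>_. True)" for S by (auto simp: graphs_on_def)
    then show "\<forall>S\<in>?I. finite (?A S)" using finite_graphs_on[OF V(1)] finite_subset by blast
    have "S = T" if "G \<in> ?A S" "G \<in> ?A T" "v \<in> S" "v \<in> T" for G S T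
      using component_unique[of G S T v] that by (simp add: components_def)
    then show "\<forall>S\<in>?I. \<forall>T\<in>?I. S \<noteq> T \<longrightarrow> ?A S \<inter> ?A T = {}" by blast
  qed
  ultimately show ?thesis
    using card_graphs_on_separated[OF V(1), of _ "\<lambda>G. conn G \<and> X G" X] by simp
qed

lemma conn_X_invariant: "iso_invariant (\<lambda>G. conn G \<and> X G)"
  using X_graph_iso conn_graph_iso unfolding iso_invariant_def by blast

text \<open>The exponential formula in recursive form: the component of the last vertex has \<open>k\<close>
  further vertices, and only their number matters for either factor.\<close>

lemma card_labeled_Suc:
  "card (labeled_graphs (Suc n) X) = (\<Sum>k\<le>n. (n choose k) *
     (card (labeled_graphs (Suc k) (\<lambda>G. conn G \<and> X G)) * card (labeled_graphs (n - k) X)))"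
proof -
  let ?c = "\<lambda>k. card (labeled_graphs k (\<lambda>G. conn G \<and> X G))" and ?l = "\<lambda>k. card (labeled_graphs k X)"
  let ?v = "Suc n" and ?V = "{1..Suc n}" and ?W = "{1..n}"
  have I: "{S. ?v \<in> S \<and> S \<subseteq> ?V} = insert ?v ` Pow ?W"
  proof
    show "insert ?v ` Pow ?W \<subseteq> {S. ?v \<in> S \<and> S \<subseteq> ?V}" by auto
    show "{S. ?v \<in> S \<and> S \<subseteq> ?V} \<subseteq> insert ?v ` Pow ?W"
    proof
      fix S assume "S \<in> {S. ?v \<in> S \<and> S \<subseteq> ?V}"
      then have S: "?v \<in> S" "S \<subseteq> ?V" by auto
      then have "S - {?v} \<in> Pow ?W" by (auto simp: le_Suc_eq)
      moreover have "S = insert ?v (S - {?v})" using S by auto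
      ultimately show "S \<in> insert ?v ` Pow ?W" by blast
    qed
  qed
  have inj: "inj_on (insert ?v) (Pow ?W)"
  proof (rule inj_onI)
    fix S T assume "S \<in> Pow ?W" "T \<in> Pow ?W" "insert ?v S = insert ?v T"
    moreover from this have "?v \<notin> S" "?v \<notin> T" by auto
    ultimately show "S = T" by (metis insert_ident)
  qed
  have "?l (Suc n) = (\<Sum>S\<in>insert ?v ` Pow ?W. card (graphs_on S (\<lambda>G. conn G \<and> X G)) * card (graphs_on (?V - S) X))"
    using card_graphs_on_component[of ?V ?v] I by (simp add: labeled_graphs_eq)
  also have "\<dots> = (\<Sum>T\<in>Pow ?W. ?c (Suc (card T)) * ?l (n - card T))"
    unfolding sum.reindex[OF inj] o_def
  proof (rule sum.cong)
    fix T assume "T \<in> Pow ?W"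
    then have T: "T \<subseteq> ?W" "finite T" "?v \<notin> T" using finite_subset[of T ?W] by auto
    have "?V - insert ?v T = ?W - T" using T by (auto simp: le_Suc_eq)
    then have "card (?V - insert ?v T) = n - card T" using T by (simp add: card_Diff_subset)
    then show "card (graphs_on (insert ?v T) (\<lambda>G. conn G \<and> X G)) * card (graphs_on (?V - insert ?v T) X) =
        ?c (Suc (card T)) * ?l (n - card T)"
      using card_graphs_on[OF conn_X_invariant, of "insert ?v T"]
        card_graphs_on[OF X_invariant, of "?V - insert ?v T"] T by simp
  qed simp
  also have "\<dots> = (\<Sum>k\<le>n. \<Sum>T\<in>{T \<in> Pow ?W. card T = k}. ?c (Suc (card T)) * ?l (n - card T))"
  proof (rule sum.group[symmetric])
    show "card ` Pow ?W \<subseteq> {..n}" using card_mono[of ?W] by fastforce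
  qed auto
  also have "\<dots> = (\<Sum>k\<le>n. (n choose k) * (?c (Suc k) * ?l (n - k)))"
    using n_subsets[of ?W] by (simp add: Pow_def)
  finally show ?thesis .
qed

end

section \<open>The two properties\<close>

text \<open>Point-determining graphs are not closed under disjoint union, because two isolated vertices
  have the same (empty) neighborhood; excluding isolated vertices makes the class additive.\<close>

definition no_isolated :: "'a pair_pre_digraph \<Rightarrow> bool" where
  "no_isolated G \<longleftrightarrow> (\<forall>v\<in>pverts G. neighborhood G v \<noteq> {})"

lemma neighborhood_eq: "pair_graph G \<Longrightarrow> neighborhood G v = {w. (v, w) \<in> parcs G}"
  by (auto simp: neighborhood_def pair_graph_iff)

lemma neighborhood_induced:
  "separated G S \<Longrightarrow> v \<in> S \<Longrightarrow> neighborhood (induced G S) v = neighborhood G v"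
  unfolding neighborhood_def separated_def by auto

lemma neighborhood_subset: "separated G S \<Longrightarrow> v \<in> S \<Longrightarrow> neighborhood G v \<subseteq> S"
  unfolding neighborhood_def separated_def by auto

lemma neighborhood_relabel:
  assumes "pair_graph G" "inj_on f (pverts G)" "v \<in> pverts G"
  shows "neighborhood (relabel f G) (f v) = f ` neighborhood G v"
proof (rule set_eqI)
  fix y
  show "y \<in> neighborhood (relabel f G) (f v) \<longleftrightarrow> y \<in> f ` neighborhood G v"
  proof
    assume "y \<in> neighborhood (relabel f G) (f v)"
    then have y: "y \<in> f ` pverts G" "(f v, y) \<in> parcs (relabel f G)" unfolding neighborhood_def by auto
    then obtain x where "x \<in> pverts G" "y = f x" by blast
    then show "y \<in> f ` neighborhood G v"
      using y(2) relabel_arc_iff[OF assms, of x] unfolding neighborhood_def by blast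
  next
    assume "y \<in> f ` neighborhood G v"
    then obtain x where "x \<in> pverts G" "y = f x" "(v, x) \<in> parcs G" unfolding neighborhood_def by blast
    then show "y \<in> neighborhood (relabel f G) (f v)"
      using relabel_arc_iff[OF assms, of x] unfolding neighborhood_def by auto
  qed
qed

lemma neighborhood_pverts: "neighborhood G v \<subseteq> pverts G"
  by (auto simp: neighborhood_def)

lemma point_determining_iff: "point_determining G \<longleftrightarrow> inj_on (neighborhood G) (pverts G)"
  unfolding point_determining_def inj_on_def by blast

lemma graph_complement_simps [simp]:
  "pverts (graph_complement G) = pverts G"
  by (simp add: graph_complement_def)

lemma neighborhood_complement:
  "v \<in> pverts G \<Longrightarrow> neighborhood (graph_complement G) v = pverts G - insert v (neighborhood G v)"
  by (auto simp: neighborhood_def graph_complement_def)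

lemma co_point_determining_iff:
  "co_point_determining G \<longleftrightarrow> inj_on (\<lambda>v. insert v (neighborhood G v)) (pverts G)"
proof -
  have "neighborhood (graph_complement G) u = neighborhood (graph_complement G) v \<longleftrightarrow>
      insert u (neighborhood G u) = insert v (neighborhood G v)" if "u \<in> pverts G" "v \<in> pverts G" for u v
    using that neighborhood_pverts[of G u] neighborhood_pverts[of G v]
    unfolding neighborhood_complement[OF that(1)] neighborhood_complement[OF that(2)] by blast
  then show ?thesis
    unfolding co_point_determining_def point_determining_iff inj_on_def by simp
qed

lemma inj_on_separated_iff:
  assumes S: "S \<subseteq> V" and cross: "\<And>u v. u \<in> S \<Longrightarrow> v \<in> V - S \<Longrightarrow> f u \<noteq> f v"
  shows "inj_on f V \<longleftrightarrow> inj_on f S \<and> inj_on f (V - S)"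
proof
  assume a: "inj_on f S \<and> inj_on f (V - S)"
  show "inj_on f V"
  proof (rule inj_onI)
    fix x y assume xy: "x \<in> V" "y \<in> V" "f x = f y"
    then have "x \<in> S \<longleftrightarrow> y \<in> S" using cross[of x y] cross[of y x] by auto
    then show "x = y" using a xy by (cases "x \<in> S") (auto dest: inj_onD)
  qed
next
  assume "inj_on f V"
  then show "inj_on f S \<and> inj_on f (V - S)" using S by (auto intro: inj_on_subset)
qed

lemma inj_on_image_family:
  assumes "inj_on f V" "\<And>v. v \<in> V \<Longrightarrow> N v \<subseteq> V" "inj_on N V"
  shows "inj_on (\<lambda>v. f ` N v) V"
proof (rule inj_onI)
  fix x y assume xy: "x \<in> V" "y \<in> V" "f ` N x = f ` N y"
  then have "N x = N y" using inj_on_image_eq_iff[OF assms(1), of "N x" "N y"] assms(2) by simp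
  then show "x = y" using xy assms(3) by (simp add: inj_on_eq_iff)
qed

text \<open>A closed neighborhood contains its own vertex and stays inside its component, so vertices in
  different components never clash.\<close>

lemma additive_co_point_determining: "additive_class co_point_determining"
proof
  show "iso_invariant (co_point_determining :: nat pair_pre_digraph \<Rightarrow> bool)"
    unfolding iso_invariant_def
  proof (intro allI impI)
    fix G H :: "nat pair_pre_digraph" assume G: "pair_graph G" "graph_iso G H" "co_point_determining G"
    then obtain f where f: "inj_on f (pverts G)" "H = relabel f G" by (auto simp: graph_iso_def)
    have "insert (f v) (neighborhood H (f v)) = f ` insert v (neighborhood G v)" if "v \<in> pverts G" for v
      using neighborhood_relabel[OF G(1) f(1) that] f(2) by simp
    moreover have "inj_on (\<lambda>v. f ` insert v (neighborhood G v)) (pverts G)"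
      by (rule inj_on_image_family[OF f(1)])
        (use G(3) neighborhood_pverts[of G] in \<open>simp_all add: co_point_determining_iff\<close>)
    ultimately have "inj_on (\<lambda>v. insert (f v) (neighborhood H (f v))) (pverts G)"
      by (simp cong: inj_on_cong)
    then show "co_point_determining H"
      unfolding co_point_determining_iff f(2) inj_on_def by auto
  qed
next
  fix G :: "nat pair_pre_digraph" and S assume G: "pair_graph G" and S: "separated G S"
  let ?N = "\<lambda>H v. insert v (neighborhood H v)"
  have *: "inj_on (?N (induced G T)) T = inj_on (?N G) T" if "separated G T" for T
    by (rule inj_on_cong) (simp add: neighborhood_induced[OF that])
  have "inj_on (?N G) (pverts G) \<longleftrightarrow> inj_on (?N G) S \<and> inj_on (?N G) (pverts G - S)"
  proof (rule inj_on_separated_iff)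
    fix u v assume "u \<in> S" "v \<in> pverts G - S"
    then have "v \<notin> ?N G u" using neighborhood_subset[OF S, of u] by auto
    then show "?N G u \<noteq> ?N G v" by auto
  qed (use S separated_subset in blast)
  then show "co_point_determining G \<longleftrightarrow>
      co_point_determining (induced G S) \<and> co_point_determining (induced G (pverts G - S))"
    by (simp add: co_point_determining_iff * S separated_Diff[OF G S])
qed (simp add: co_point_determining_iff)

text \<open>Nonempty neighborhoods in different components lie in disjoint sets, hence differ.\<close>

lemma additive_pd_no_isolated: "additive_class (\<lambda>G. point_determining G \<and> no_isolated G)"
proof
  show "iso_invariant (\<lambda>G :: nat pair_pre_digraph. point_determining G \<and> no_isolated G)"
    unfolding iso_invariant_def
  proof (intro allI impI)
    fix G H :: "nat pair_pre_digraph" assume G: "pair_graph G" "graph_iso G H" "point_determining G \<and> no_isolated G"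
    then obtain f where f: "inj_on f (pverts G)" "H = relabel f G" by (auto simp: graph_iso_def)
    have N: "neighborhood H (f v) = f ` neighborhood G v" if "v \<in> pverts G" for v
      using neighborhood_relabel[OF G(1) f(1) that] f(2) by simp
    have "inj_on (\<lambda>v. f ` neighborhood G v) (pverts G)"
      by (rule inj_on_image_family[OF f(1)])
        (use G(3) neighborhood_pverts[of G] in \<open>simp_all add: point_determining_iff\<close>)
    then have "inj_on (\<lambda>v. neighborhood H (f v)) (pverts G)"
      using N by (simp cong: inj_on_cong)
    then have "point_determining H"
      unfolding point_determining_iff f(2) inj_on_def by auto
    moreover have "no_isolated H" using N G(3) unfolding no_isolated_def f(2) by auto
    ultimately show "point_determining H \<and> no_isolated H" ..
  qed
next
  fix G :: "nat pair_pre_digraph" and S assume G: "pair_graph G" and S: "separated G S"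
  note S' = separated_Diff[OF G S] and sub = separated_subset[OF S]
  have iso: "no_isolated (induced G T) \<longleftrightarrow> (\<forall>v\<in>T. neighborhood G v \<noteq> {})" if "separated G T" for T
    using neighborhood_induced[OF that] by (simp add: no_isolated_def)
  have 1: "no_isolated G \<longleftrightarrow> no_isolated (induced G S) \<and> no_isolated (induced G (pverts G - S))"
    unfolding iso[OF S] iso[OF S'] unfolding no_isolated_def using sub by blast
  have *: "inj_on (neighborhood (induced G T)) T = inj_on (neighborhood G) T" if "separated G T" for T
    by (rule inj_on_cong) (simp add: neighborhood_induced[OF that])
  have "inj_on (neighborhood G) (pverts G) \<longleftrightarrow> inj_on (neighborhood G) S \<and> inj_on (neighborhood G) (pverts G - S)"
    if ni: "no_isolated G"
  proof (rule inj_on_separated_iff[OF sub])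
    fix u v assume uv: "u \<in> S" "v \<in> pverts G - S"
    then have "neighborhood G u \<noteq> {}" using ni sub unfolding no_isolated_def by blast
    then show "neighborhood G u \<noteq> neighborhood G v"
      using neighborhood_subset[OF S uv(1)] neighborhood_subset[OF S' uv(2)] by blast
  qed
  then show "point_determining G \<and> no_isolated G \<longleftrightarrow>
      (point_determining (induced G S) \<and> no_isolated (induced G S)) \<and>
      (point_determining (induced G (pverts G - S)) \<and> no_isolated (induced G (pverts G - S)))"
    using 1 by (auto simp: point_determining_iff * S S')
qed (simp add: point_determining_iff no_isolated_def)

text \<open>A point-determining graph has at most one isolated vertex; this is the only obstruction to
  additivity, and accounts for the factor \<open>1 + x\<close> in both counts.\<close>

lemma point_determining_isolated_iff:
  assumes G: "pair_graph G"
  shows "point_determining G \<longleftrightarrow> (point_determining G \<and> no_isolated G) \<or>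
    (\<exists>v\<in>pverts G. separated G {v} \<and>
      point_determining (induced G (pverts G - {v})) \<and> no_isolated (induced G (pverts G - {v})))"
proof -
  have N: "inj_on (neighborhood (induced G (pverts G - {v}))) (pverts G - {v}) = inj_on (neighborhood G) (pverts G - {v})"
      "no_isolated (induced G (pverts G - {v})) \<longleftrightarrow> (\<forall>u\<in>pverts G - {v}. neighborhood G u \<noteq> {})"
    if "separated G {v}" for v
  proof -
    note s = separated_Diff[OF G that]
    show "inj_on (neighborhood (induced G (pverts G - {v}))) (pverts G - {v}) = inj_on (neighborhood G) (pverts G - {v})"
      by (rule inj_on_cong) (simp add: neighborhood_induced[OF s])
    show "no_isolated (induced G (pverts G - {v})) \<longleftrightarrow> (\<forall>u\<in>pverts G - {v}. neighborhood G u \<noteq> {})"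
      using neighborhood_induced[OF s] by (simp add: no_isolated_def)
  qed
  show ?thesis
  proof (intro iffI)
    assume pd: "point_determining G"
    show "(point_determining G \<and> no_isolated G) \<or> (\<exists>v\<in>pverts G. separated G {v} \<and>
      point_determining (induced G (pverts G - {v})) \<and> no_isolated (induced G (pverts G - {v})))"
    proof (cases "no_isolated G")
      case False
      then obtain v where v: "v \<in> pverts G" "neighborhood G v = {}" unfolding no_isolated_def by blast
      have "separated G {v}"
      proof (rule separatedI)
        fix x y assume "(x, y) \<in> parcs G"
        then show "x \<in> {v} \<longleftrightarrow> y \<in> {v}"
          using v(2) pair_graph_sym[OF G, of x y] by (auto simp: neighborhood_eq[OF G])
      qed (use v in simp)
      moreover have "inj_on (neighborhood G) (pverts G - {v})"
        using pd unfolding point_determining_iff by (rule inj_on_subset) blast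
      moreover have "neighborhood G u \<noteq> {}" if "u \<in> pverts G - {v}" for u
        using pd v that unfolding point_determining_def by fastforce
      ultimately show ?thesis using v N[of v] by (auto simp: point_determining_iff)
    qed (use pd in blast)
  next
    assume "(point_determining G \<and> no_isolated G) \<or> (\<exists>v\<in>pverts G. separated G {v} \<and>
      point_determining (induced G (pverts G - {v})) \<and> no_isolated (induced G (pverts G - {v})))"
    then show "point_determining G"
    proof
      assume "\<exists>v\<in>pverts G. separated G {v} \<and>
        point_determining (induced G (pverts G - {v})) \<and> no_isolated (induced G (pverts G - {v}))"
      then obtain v where v: "v \<in> pverts G" "separated G {v}"
        "point_determining (induced G (pverts G - {v}))" "no_isolated (induced G (pverts G - {v}))" by blast
      then have inj: "inj_on (neighborhood G) (pverts G - {v})"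
        and ne: "\<forall>u\<in>pverts G - {v}. neighborhood G u \<noteq> {}"
        using N[OF v(2)] by (simp_all add: point_determining_iff)
      have "neighborhood G v \<subseteq> {v}" using neighborhood_subset[OF v(2)] by simp
      moreover have "v \<notin> neighborhood G v" using G by (auto simp: neighborhood_def pair_graph_iff irrefl_def)
      ultimately have "neighborhood G v = {}" by blast
      then have "neighborhood G v \<notin> neighborhood G ` (pverts G - {v})" using ne by auto
      then show "point_determining G"
        using inj inj_on_insert[of "neighborhood G" v "pverts G - {v}"] insert_Diff[OF v(1)]
        by (simp add: point_determining_iff)
    qed blast
  qed
qed

lemma graph_complement_complement:
  "pair_graph G \<Longrightarrow> graph_complement (graph_complement G) = G"
  by (auto simp: graph_complement_def pair_graph_iff irrefl_def intro!: pair_pre_digraph.equality)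

lemma graph_complement_relabel:
  assumes G: "pair_graph G" and f: "inj_on f (pverts G)"
  shows "graph_complement (relabel f G) = relabel f (graph_complement G)"
proof (rule pair_pre_digraph.equality)
  have "(p, q) \<in> parcs (graph_complement (relabel f G)) \<longleftrightarrow> (p, q) \<in> parcs (relabel f (graph_complement G))" for p q
  proof (cases "p \<in> f ` pverts G \<and> q \<in> f ` pverts G")
    case True
    then obtain x y where xy: "x \<in> pverts G" "y \<in> pverts G" "p = f x" "q = f y" by auto
    have "(p, q) \<in> parcs (relabel f (graph_complement G)) \<longleftrightarrow> (x, y) \<in> parcs (graph_complement G)"
      unfolding xy using relabel_arc_iff[OF pair_graph_graph_complement[OF G], of f x y] f xy by simp
    also have "\<dots> \<longleftrightarrow> x \<noteq> y \<and> (x, y) \<notin> parcs G" using xy by (simp add: graph_complement_def)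
    also have "\<dots> \<longleftrightarrow> f x \<noteq> f y \<and> (f x, f y) \<notin> parcs (relabel f G)"
      using relabel_arc_iff[OF G f xy(1,2)] inj_on_eq_iff[OF f xy(1,2)] by simp
    also have "\<dots> \<longleftrightarrow> (p, q) \<in> parcs (graph_complement (relabel f G))"
      using xy by (simp add: graph_complement_def del: relabel_simps(2))
    finally show ?thesis by simp
  next
    case False
    then show ?thesis by (auto simp: graph_complement_def)
  qed
  then show "parcs (graph_complement (relabel f G)) = parcs (relabel f (graph_complement G))" by auto
qed simp_all

lemma graph_iso_complement:
  assumes "pair_graph G" "graph_iso G H" shows "graph_iso (graph_complement G) (graph_complement H)"
  using assms graph_complement_relabel by (auto simp: graph_iso_def)

lemma graph_iso_complement_iff:
  "pair_graph G \<Longrightarrow> pair_graph H \<Longrightarrow> graph_iso (graph_complement G) (graph_complement H) \<longleftrightarrow> graph_iso G H"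
  using graph_iso_complement[of G H] graph_iso_complement[of "graph_complement G" "graph_complement H"]
  by (auto simp: graph_complement_complement pair_graph_graph_complement)

lemma image_graph_complement:
  "graph_complement ` {G. pair_graph G \<and> Q (pverts G) \<and> point_determining G} =
   {G. pair_graph G \<and> Q (pverts G) \<and> co_point_determining G}" (is "_ ` ?A = ?B")
proof
  show "graph_complement ` ?A \<subseteq> ?B"
    by (auto simp: co_point_determining_def graph_complement_complement pair_graph_graph_complement)
  show "?B \<subseteq> graph_complement ` ?A"
  proof
    fix G assume "G \<in> ?B"
    then have "graph_complement G \<in> ?A" "G = graph_complement (graph_complement G)"
      by (auto simp: co_point_determining_def graph_complement_complement pair_graph_graph_complement)
    then show "G \<in> graph_complement ` ?A" by (rule rev_image_eqI)
  qed
qed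

lemma card_labeled_complement:
  "card (labeled_graphs n co_point_determining) = card (labeled_graphs n point_determining)"
proof -
  have "labeled_graphs n co_point_determining = graph_complement ` labeled_graphs n point_determining"
    using image_graph_complement[of "\<lambda>V. V = {1..n}"] by (simp add: labeled_graphs_def)
  moreover have "inj_on graph_complement (labeled_graphs n point_determining)"
    by (rule inj_on_inverseI[of _ graph_complement]) (simp add: labeled_graphs_def graph_complement_complement)
  ultimately show ?thesis by (simp add: card_image)
qed

text \<open>With its labelled companion, this is where the two properties meet: among all graphs,
  not just the connected ones, complementation makes them equinumerous.\<close>

lemma card_unlabeled_complement:
  "card (unlabeled_graphs n co_point_determining) = card (unlabeled_graphs n point_determining)"
proof -
  let ?A = "{G. pair_graph G \<and> card (pverts G) = n \<and> point_determining G}"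
  have "unlabeled_graphs n co_point_determining = (\<lambda>G. iso_class (graph_complement G)) ` ?A"
    using arg_cong[OF image_graph_complement[of "\<lambda>V. card V = n"], of "image iso_class"]
    by (simp add: unlabeled_graphs_eq image_image)
  moreover have "card ((\<lambda>G. iso_class (graph_complement G)) ` ?A) = card (iso_class ` ?A)"
    by (rule card_image_cong_eq)
      (simp add: iso_class_eq_iff pair_graph_graph_complement graph_iso_complement_iff)
  ultimately show ?thesis by (simp add: unlabeled_graphs_eq)
qed

section \<open>Unlabelled connected graphs\<close>

abbreviation pd_no_isolated :: "nat pair_pre_digraph \<Rightarrow> bool" where
  "pd_no_isolated G \<equiv> point_determining G \<and> no_isolated G"

interpretation co_pd: additive_class co_point_determining by (rule additive_co_point_determining)
interpretation pd_ni: additive_class pd_no_isolated by (rule additive_pd_no_isolated)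

definition point :: "nat pair_pre_digraph" where
  "point = \<lparr>pverts = {0}, parcs = {}\<rparr>"

definition edge :: "nat pair_pre_digraph" where
  "edge = \<lparr>pverts = {0, 1}, parcs = {(0, 1), (1, 0)}\<rparr>"

lemma pair_graph_point: "pair_graph point"
  by (simp add: pair_graph_iff point_def sym_def irrefl_def)

lemma pair_graph_edge: "pair_graph edge"
  by (auto simp: pair_graph_iff edge_def sym_def irrefl_def)

lemma conn_point: "conn point"
  unfolding conn_iff_separated[OF pair_graph_point] by (auto simp: point_def separated_def)

lemma conn_edge: "conn edge"
  unfolding conn_iff_separated[OF pair_graph_edge] by (auto simp: edge_def separated_def)

lemma co_point_determining_point: "co_point_determining point"
  by (simp add: co_point_determining_iff point_def)

lemma neighborhood_edge: "neighborhood edge 0 = {1}" "neighborhood edge (Suc 0) = {0}"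
  by (auto simp: neighborhood_def edge_def)

lemma pd_no_isolated_edge: "pd_no_isolated edge"
  using neighborhood_edge by (auto simp: point_determining_def no_isolated_def edge_def)

lemma point_in_connected_classes: "iso_class point \<in> connected_classes co_point_determining"
  unfolding connected_classes_def using pair_graph_point conn_point co_point_determining_point by blast

lemma edge_in_connected_classes: "iso_class edge \<in> connected_classes pd_no_isolated"
  unfolding connected_classes_def using pair_graph_edge conn_edge pd_no_isolated_edge by blast

lemma point_notin_connected_classes: "iso_class point \<notin> connected_classes pd_no_isolated"
proof
  assume "iso_class point \<in> connected_classes pd_no_isolated"
  then obtain G where G: "pair_graph G" "pd_no_isolated G" "iso_class G = iso_class point" by (auto simp: connected_classes_def)
  then have "pd_no_isolated point" using pd_ni.X_graph_iso iso_class_eq_iff pair_graph_point by blast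
  then show False by (simp add: no_isolated_def neighborhood_def point_def)
qed

lemma graph_order_point: "graph_order (iso_class point) = 1"
  using graph_order_iso_class[OF pair_graph_point] by (simp add: point_def)

lemma graph_order_edge: "graph_order (iso_class edge) = 2"
  using graph_order_iso_class[OF pair_graph_edge] by (simp add: edge_def)

lemma induced_singleton: "pair_graph G \<Longrightarrow> induced G {v} = \<lparr>pverts = {v}, parcs = {}\<rparr>"
  by (auto simp: induced_def pair_graph_iff irrefl_def)

lemma graph_iso_point: "graph_iso point \<lparr>pverts = {v}, parcs = {}\<rparr>"
  unfolding graph_iso_def by (intro exI[of _ "\<lambda>_. v"]) (simp add: point_def relabel_def)

lemma iso_class_induced_singleton:
  assumes "pair_graph G" "v \<in> pverts G" shows "iso_class point = iso_class (induced G {v})"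
  using iso_class_eq_iff[OF pair_graph_point pair_graph_induced[OF assms(1), of "{v}"]] graph_iso_point assms(2)
  by (simp add: induced_singleton[OF assms(1)])

lemma conn_no_isolated:
  assumes G: "pair_graph G" "conn G" and "2 \<le> card (pverts G)"
  shows "no_isolated G"
  unfolding no_isolated_def
proof
  fix v assume v: "v \<in> pverts G"
  show "neighborhood G v \<noteq> {}"
  proof
    assume "neighborhood G v = {}"
    then have "separated G {v}"
      by (intro separatedI) (use v pair_graph_sym[OF G(1)] in \<open>auto simp: neighborhood_eq[OF G(1)]\<close>)
    then have "pverts G = {v}" using G conn_iff_separated by blast
    then show False using assms(3) by simp
  qed
qed

lemma unlabeled_conn_pd_no_isolated:
  assumes "2 \<le> n"
  shows "unlabeled_graphs n (\<lambda>G. conn G \<and> pd_no_isolated G) = unlabeled_graphs n (\<lambda>G. conn G \<and> point_determining G)"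
proof -
  have "{G. pair_graph G \<and> card (pverts G) = n \<and> conn G \<and> pd_no_isolated G} =
      {G. pair_graph G \<and> card (pverts G) = n \<and> conn G \<and> point_determining G}"
    using conn_no_isolated assms by blast
  then show ?thesis unfolding unlabeled_graphs_eq by simp
qed

lemma labeled_conn_pd_no_isolated:
  assumes "2 \<le> n"
  shows "labeled_graphs n (\<lambda>G. conn G \<and> pd_no_isolated G) = labeled_graphs n (\<lambda>G. conn G \<and> point_determining G)"
proof -
  have "no_isolated G" if "pair_graph G" "pverts G = {1..n}" "conn G" for G
    using conn_no_isolated[OF that(1,3)] that(2) assms by simp
  then show ?thesis unfolding labeled_graphs_def by blast
qed

abbreviation multiset_count :: "nat pair_pre_digraph set set \<Rightarrow> nat \<Rightarrow> nat" where
  "multiset_count S n \<equiv> card (weighted_msets graph_order S n)"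

lemma component_classes_image_point_determining:
  "component_classes ` {G. pair_graph G \<and> card (pverts G) = n \<and> point_determining G} =
    weighted_msets graph_order (connected_classes pd_no_isolated) n \<union>
    (if 1 \<le> n then add_mset (iso_class point) ` weighted_msets graph_order (connected_classes pd_no_isolated) (n - 1) else {})"
  (is "component_classes ` ?A = ?B \<union> ?C")
proof
  show "component_classes ` ?A \<subseteq> ?B \<union> ?C"
  proof (rule image_subsetI)
    fix G assume "G \<in> ?A"
    then have G: "pair_graph G" "card (pverts G) = n" "point_determining G" by auto
    have fin: "finite (pverts G)" using pair_graph_finite[OF G(1)] .
    from iffD1[OF point_determining_isolated_iff[OF G(1)] G(3)] show "component_classes G \<in> ?B \<union> ?C"
    proof
      assume "pd_no_isolated G"
      then have "component_classes G \<in> ?B" unfolding pd_ni.component_classes_image[symmetric] using G by blast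
      then show ?thesis by blast
    next
      assume "\<exists>v\<in>pverts G. separated G {v} \<and> pd_no_isolated (induced G (pverts G - {v}))"
      then obtain v where v: "v \<in> pverts G" "separated G {v}" "pd_no_isolated (induced G (pverts G - {v}))" by blast
      let ?H = "induced G (pverts G - {v})"
      have "component_classes (induced G {v}) = {#iso_class point#}"
      proof -
        have pg: "pair_graph (induced G {v})" using pair_graph_induced[OF G(1)] v(1) by simp
        have "graph_iso point (induced G {v})" using graph_iso_point induced_singleton[OF G(1)] by simp
        then have "conn (induced G {v})" using conn_graph_iso[OF pair_graph_point conn_point] by blast
        then show ?thesis using component_classes_conn[OF pg] iso_class_induced_singleton[OF G(1) v(1)] by simp
      qed
      then have "component_classes G = add_mset (iso_class point) (component_classes ?H)"
        using component_classes_separated[OF G(1) v(2)] by simp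
      moreover have "card (pverts ?H) = n - 1" using G(2) v(1) fin by simp
      moreover have "pair_graph ?H" using pair_graph_induced[OF G(1)] by blast
      moreover have "1 \<le> n" using G(2) v(1) fin card_gt_0_iff[of "pverts G"] by auto
      moreover have "component_classes ?H \<in> weighted_msets graph_order (connected_classes pd_no_isolated) (n - 1)"
        unfolding pd_ni.component_classes_image[symmetric] using calculation v(3) by blast
      ultimately show ?thesis by simp
    qed
  qed
  have "?B \<subseteq> component_classes ` ?A" unfolding pd_ni.component_classes_image[symmetric] by blast
  moreover have "?C \<subseteq> component_classes ` ?A"
  proof
    fix M assume M: "M \<in> ?C"
    then have n: "1 \<le> n" by (simp split: if_splits)
    then obtain M' where M': "M = add_mset (iso_class point) M'" "M' \<in> weighted_msets graph_order (connected_classes pd_no_isolated) (n - 1)"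
      using M by auto
    then obtain G where G: "pair_graph G" "card (pverts G) = n - 1" "pd_no_isolated G" "component_classes G = M'"
      unfolding pd_ni.component_classes_image[symmetric] by blast
    obtain H where H: "graph_iso point H" "pair_graph H" "pverts G \<inter> pverts H = {}"
      "component_classes (glue G H) = add_mset (iso_class point) (component_classes G)"
      using pd_ni.component_classes_glue_fresh[OF G(1) pair_graph_point conn_point] .
    obtain v where v: "pverts H = {v}" using H(1) by (auto simp: graph_iso_def point_def)
    let ?K = "glue G H"
    have K: "pair_graph ?K" using pair_graph_glue G(1) H(2) .
    have d: "pverts ?K - {v} = pverts G" using v H(3) by auto
    have "separated ?K (pverts ?K - pverts G)"
      using separated_Diff[OF K separated_glue[OF G(1) H(2,3)]] .
    moreover have "pverts ?K - pverts G = {v}" using v H(3) by auto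
    ultimately have "separated ?K {v}" by simp
    moreover have "pd_no_isolated (induced ?K (pverts ?K - {v}))"
      unfolding d using induced_glue(1)[OF G(1) H(2,3)] G(3) by simp
    moreover have "v \<in> pverts ?K" using v by simp
    ultimately have "point_determining ?K" using point_determining_isolated_iff[OF K] by blast
    moreover have "card (pverts ?K) = n"
      using G(2) v H(3) n pair_graph_finite[OF G(1)] by simp
    ultimately have "?K \<in> ?A" using K by blast
    moreover have "M = component_classes ?K" using H(4) G(4) M'(1) by simp
    ultimately show "M \<in> component_classes ` ?A" by (rule rev_image_eqI)
  qed
  ultimately show "?B \<union> ?C \<subseteq> component_classes ` ?A" by blast
qed

lemma card_unlabeled_point_determining:
  "card (unlabeled_graphs n point_determining) =
    multiset_count (connected_classes pd_no_isolated) n + (if 1 \<le> n then multiset_count (connected_classes pd_no_isolated) (n - 1) else 0)"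
proof -
  let ?B = "weighted_msets graph_order (connected_classes pd_no_isolated) n"
  let ?C = "if 1 \<le> n then add_mset (iso_class point) ` weighted_msets graph_order (connected_classes pd_no_isolated) (n - 1) else {}"
  have "M \<notin> ?C" if "M \<in> ?B" for M
  proof
    assume "M \<in> ?C"
    then have "iso_class point \<in># M" by (auto split: if_splits)
    then show False using that point_notin_connected_classes by (auto simp: weighted_msets_def)
  qed
  then have "?B \<inter> ?C = {}" by blast
  moreover have "finite ?B" "finite ?C" using pd_ni.finite_weighted_msets by auto
  ultimately have "card (?B \<union> ?C) = card ?B + card ?C" by (intro card_Un_disjoint)
  moreover have "card (add_mset (iso_class point) ` Y) = card Y" for Y
    by (rule card_image) (simp add: inj_on_def)
  ultimately show ?thesis unfolding card_unlabeled_component_classes component_classes_image_point_determining by simp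
qed

text \<open>Adding the class of a point to arbitrary multisets of the other connected co-point-determining
  graphs multiplies the series by \<open>1 / (1 - x)\<close>; on the other side, the optional isolated vertex
  and arbitrarily many copies of the single edge contribute
  \<open>(1 + x) / (1 - x ^ 2) = 1 / (1 - x)\<close> as well. So the
  remaining connected graphs on either side generate the same series.\<close>

lemma multiset_count_connected_classes_eq:
  "multiset_count (connected_classes co_point_determining - {iso_class point}) n = multiset_count (connected_classes pd_no_isolated - {iso_class edge}) n"
proof -
  let ?S = "connected_classes co_point_determining" and ?T = "connected_classes pd_no_isolated"
  have a: "multiset_count ?S m = multiset_count ?T m + (if 1 \<le> m then multiset_count ?T (m - 1) else 0)" for m
    using co_pd.card_unlabeled card_unlabeled_complement card_unlabeled_point_determining by metis
  have S: "multiset_count ?S n = multiset_count (?S - {iso_class point}) n + (if 1 \<le> n then multiset_count ?S (n - 1) else 0)"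
    using card_weighted_msets_remove[OF point_in_connected_classes co_pd.finite_weighted_msets] graph_order_point by simp
  have T: "multiset_count ?T n = multiset_count (?T - {iso_class edge}) n + (if 2 \<le> n then multiset_count ?T (n - 2) else 0)"
    using card_weighted_msets_remove[OF edge_in_connected_classes pd_ni.finite_weighted_msets] graph_order_edge by simp
  consider "n = 0" | "n = 1" | m where "n = Suc (Suc m)" by (metis One_nat_def not0_implies_Suc)
  then show ?thesis
  proof cases
    case 3
    then show ?thesis using S T a[of n] a[of "n - 1"] by (simp add: numeral_2_eq_2)
  qed (use S T a[of 0] a[of 1] in auto)
qed

lemma card_unlabeled_connected_eq:
  assumes "2 < n"
  shows "card (unlabeled_graphs n (\<lambda>G. conn G \<and> point_determining G)) =
    card (unlabeled_graphs n (\<lambda>G. conn G \<and> co_point_determining G))"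
proof -
  let ?S = "connected_classes co_point_determining" and ?T = "connected_classes pd_no_isolated"
  have fin: "finite (weighted_msets graph_order (?S - {iso_class point}) m)" "finite (weighted_msets graph_order (?T - {iso_class edge}) m)" for m
    using finite_subset[OF weighted_msets_mono co_pd.finite_weighted_msets]
      finite_subset[OF weighted_msets_mono pd_ni.finite_weighted_msets] by blast+
  have "card {K \<in> ?S - {iso_class point}. graph_order K = n} = card {K \<in> ?T - {iso_class edge}. graph_order K = n}"
  proof (rule weighted_atoms_unique)
    show "0 < graph_order K" if "K \<in> (?S - {iso_class point}) \<union> (?T - {iso_class edge})" for K
      using that graph_order_connected_classes_pos by blast
  qed (use fin multiset_count_connected_classes_eq in simp_all)
  moreover have "{K \<in> ?S - {iso_class point}. graph_order K = n} = {K \<in> ?S. graph_order K = n}"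
    using graph_order_point assms by auto
  moreover have "{K \<in> ?T - {iso_class edge}. graph_order K = n} = {K \<in> ?T. graph_order K = n}"
    using graph_order_edge assms by auto
  ultimately show ?thesis using unlabeled_conn_pd_no_isolated[of n] assms by (simp add: connected_classes_of_order)
qed

section \<open>Labelled connected graphs\<close>

lemma card_labeled_point_determining:
  "card (labeled_graphs n point_determining) = card (labeled_graphs n pd_no_isolated) + n * card (labeled_graphs (n - 1) pd_no_isolated)"
proof -
  let ?V = "{1..n}"
  let ?A = "\<lambda>v. {G. pair_graph G \<and> pverts G = ?V \<and> separated G {v} \<and> (\<lambda>_. True) (induced G {v}) \<and> pd_no_isolated (induced G (?V - {v}))}"
  have eq: "labeled_graphs n point_determining = graphs_on ?V pd_no_isolated \<union> (\<Union>v\<in>?V. ?A v)" (is "?L = _ \<union> ?U")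
  proof (rule set_eqI)
    fix G
    show "G \<in> ?L \<longleftrightarrow> G \<in> graphs_on ?V pd_no_isolated \<union> ?U"
    proof (cases "pair_graph G \<and> pverts G = ?V")
      case True
      then show ?thesis using point_determining_isolated_iff[of G] by (auto simp: labeled_graphs_def graphs_on_def)
    next
      case False
      then show ?thesis by (auto simp: labeled_graphs_def graphs_on_def)
    qed
  qed
  have nb: "neighborhood G v = {}" if "G \<in> ?A v" for G v
  proof -
    have "neighborhood G v \<subseteq> {v}" using neighborhood_subset[of G "{v}" v] that by simp
    moreover have "v \<notin> neighborhood G v" using that by (auto simp: neighborhood_def pair_graph_iff irrefl_def)
    ultimately show ?thesis by blast
  qed
  have ne: "neighborhood G w \<noteq> {}" if "G \<in> ?A v" "w \<in> ?V - {v}" for G v w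
  proof -
    have "separated G (?V - {v})" using that(1) separated_Diff[of G "{v}"] by auto
    moreover have "neighborhood (induced G (?V - {v})) w \<noteq> {}" using that unfolding no_isolated_def by auto
    ultimately show ?thesis using neighborhood_induced that(2) by metis
  qed
  have finA: "finite (?A v)" for v
    by (rule finite_subset[OF _ finite_graphs_on[of ?V "\<lambda>_. True"]]) (auto simp: graphs_on_def)
  have cA: "card (?A v) = card (labeled_graphs (n - 1) pd_no_isolated)" if "v \<in> ?V" for v
  proof -
    have "graphs_on {v} (\<lambda>_. True) = {\<lparr>pverts = {v}, parcs = {}\<rparr>}"
      by (auto simp: graphs_on_def pair_graph_iff irrefl_def sym_def intro!: pair_pre_digraph.equality)
    then have "card (graphs_on {v} (\<lambda>_. True)) = 1" by simp
    moreover have "card (graphs_on (?V - {v}) pd_no_isolated) = card (labeled_graphs (n - 1) pd_no_isolated)"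
      using card_graphs_on[OF pd_ni.X_invariant, of "?V - {v}"] that by simp
    moreover have "card (?A v) = card (graphs_on {v} (\<lambda>_. True)) * card (graphs_on (?V - {v}) pd_no_isolated)"
      by (rule card_graphs_on_separated) (use that in auto)
    ultimately show ?thesis by simp
  qed
  have disj: "v = w" if "G \<in> ?A v" "G \<in> ?A w" "w \<in> ?V" for G v w
    using nb[OF that(2)] ne[OF that(1), of w] that(3) by blast
  have "card ?U = (\<Sum>v\<in>?V. card (?A v))"
    by (rule card_UN_disjoint) (use finA disj in blast)+
  also have "\<dots> = n * card (labeled_graphs (n - 1) pd_no_isolated)" using cA by simp
  finally have cU: "card ?U = n * card (labeled_graphs (n - 1) pd_no_isolated)" .
  have "G \<notin> graphs_on ?V pd_no_isolated" if "G \<in> ?A v" "v \<in> ?V" for G v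
    using nb[OF that(1)] that(2) by (auto simp: graphs_on_def no_isolated_def)
  then have "graphs_on ?V pd_no_isolated \<inter> ?U = {}" by blast
  moreover have "finite (graphs_on ?V pd_no_isolated)" "finite ?U" using finite_graphs_on finA by auto
  ultimately have "card (graphs_on ?V pd_no_isolated \<union> ?U) = card (graphs_on ?V pd_no_isolated) + card ?U"
    by (intro card_Un_disjoint)
  then show ?thesis unfolding eq cU by (simp add: labeled_graphs_eq)
qed

definition egf :: "(nat \<Rightarrow> nat) \<Rightarrow> real fps" where
  "egf f = Abs_fps (\<lambda>n. real (f n) / fact n)"

lemma fps_deriv_egf: "fps_deriv (egf f) = egf (\<lambda>n. f (Suc n))"
  by (rule fps_ext) (simp add: egf_def del: of_nat_Suc)

text \<open>The recursion over the component of a vertex is the derivative of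
  \<open>egf f = exp (egf c)\<close>; in this form no logarithm is needed.\<close>

lemma fps_deriv_egf_component:
  assumes "\<And>n. f (Suc n) = (\<Sum>k\<le>n. (n choose k) * (c (Suc k) * f (n - k)))"
  shows "fps_deriv (egf f) = fps_deriv (egf c) * egf f"
proof (rule fps_ext)
  fix n
  have "fps_nth (fps_deriv (egf f)) n = (\<Sum>k\<le>n. real (n choose k) * (real (c (Suc k)) * real (f (n - k)))) / fact n"
    by (simp add: fps_deriv_egf egf_def assms)
  also have "\<dots> = (\<Sum>k\<le>n. real (c (Suc k)) / fact k * (real (f (n - k)) / fact (n - k)))"
    unfolding sum_divide_distrib by (rule sum.cong) (simp_all add: binomial_fact)
  also have "\<dots> = fps_nth (fps_deriv (egf c) * egf f) n"
    by (simp add: fps_deriv_egf egf_def fps_mult_nth atMost_atLeast0)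
  finally show "fps_nth (fps_deriv (egf f)) n = fps_nth (fps_deriv (egf c) * egf f) n" .
qed

text \<open>With \<open>A = (1 + x) Z\<close>, \<open>A' = Q' A\<close> and \<open>Z' = C' Z\<close>, cancelling \<open>Z\<close> gives
  \<open>(1 + x) (Q' - C') = 1\<close>, that is, \<open>Q - C = log (1 + x)\<close>, whose
  coefficients are \<open>(n - 1)! / n!\<close> up to sign.\<close>

lemma card_labeled_connected_diff:
  "\<bar>int (card (labeled_graphs (Suc n) (\<lambda>G. conn G \<and> pd_no_isolated G))) -
    int (card (labeled_graphs (Suc n) (\<lambda>G. conn G \<and> co_point_determining G)))\<bar> = fact n"
proof -
  define a z c q where
    "a n = card (labeled_graphs n point_determining)" and
    "z n = card (labeled_graphs n pd_no_isolated)" and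
    "c n = card (labeled_graphs n (\<lambda>G. conn G \<and> pd_no_isolated G))" and
    "q n = card (labeled_graphs n (\<lambda>G. conn G \<and> co_point_determining G))" for n
  have A': "fps_deriv (egf a) = fps_deriv (egf q) * egf a"
    by (rule fps_deriv_egf_component)
      (simp add: a_def q_def co_pd.card_labeled_Suc flip: card_labeled_complement)
  have Z': "fps_deriv (egf z) = fps_deriv (egf c) * egf z"
    by (rule fps_deriv_egf_component) (simp add: z_def c_def pd_ni.card_labeled_Suc)
  have az: "egf a = (1 + fps_X) * egf z"
  proof (rule fps_ext)
    fix m
    have "a m = z m + m * z (m - 1)" unfolding a_def z_def by (rule card_labeled_point_determining)
    then show "fps_nth (egf a) m = fps_nth ((1 + fps_X) * egf z) m"
      by (cases m) (simp_all add: egf_def distrib_right add_divide_distrib del: of_nat_Suc mult_Suc)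
  qed
  have "labeled_graphs 0 pd_no_isolated = {\<lparr>pverts = {}, parcs = {}\<rparr>}"
    by (auto simp: labeled_graphs_def pair_graph_iff irrefl_def sym_def point_determining_def no_isolated_def
        intro!: pair_pre_digraph.equality)
  then have "fps_nth (egf z) 0 = 1" by (simp add: egf_def z_def)
  then have nz: "egf z \<noteq> 0" by auto
  define d where "d = fps_deriv (egf q) - fps_deriv (egf c)"
  have "(1 + (1 + fps_X) * fps_deriv (egf c)) * egf z = ((1 + fps_X) * fps_deriv (egf q)) * egf z"
    using A' unfolding az by (simp add: Z' algebra_simps)
  then have "1 + (1 + fps_X) * fps_deriv (egf c) = (1 + fps_X) * fps_deriv (egf q)" using nz by simp
  then have d: "(1 + fps_X) * d = 1" by (simp add: d_def algebra_simps)
  have "fps_nth d m = (-1) ^ m" for m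
  proof (induction m)
    case 0
    show ?case using arg_cong[OF d, of "\<lambda>f. fps_nth f 0"] by (simp add: distrib_right)
  next
    case (Suc m)
    show ?case using arg_cong[OF d, of "\<lambda>f. fps_nth f (Suc m)"] Suc by (simp add: distrib_right)
  qed
  then have "(real (q (Suc n)) - real (c (Suc n))) / fact n = (-1) ^ n"
    by (simp add: d_def fps_deriv_egf egf_def diff_divide_distrib flip: fps_deriv_egf)
  then have "real (q (Suc n)) - real (c (Suc n)) = (-1) ^ n * fact n" by (simp add: field_simps)
  then have "\<bar>real (q (Suc n)) - real (c (Suc n))\<bar> = fact n" by (simp add: abs_mult)
  then have "\<bar>real (c (Suc n)) - real (q (Suc n))\<bar> = fact n" by (subst abs_minus_commute)
  then have "real_of_int \<bar>int (c (Suc n)) - int (q (Suc n))\<bar> = real_of_int (fact n)" by simp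
  then show ?thesis unfolding of_int_eq_iff c_def q_def .
qed

theorem mainTheorem3:
  fixes n :: nat
  assumes "n > 2"
  shows "card (unlabeled_graphs n (\<lambda>G. Digraph_Component.connected (with_proj G) \<and> point_determining G)) =
         card (unlabeled_graphs n (\<lambda>G. Digraph_Component.connected (with_proj G) \<and> co_point_determining G))
       \<and> \<bar>int (card (labeled_graphs n (\<lambda>G. Digraph_Component.connected (with_proj G) \<and> point_determining G))) -
         int (card (labeled_graphs n (\<lambda>G. Digraph_Component.connected (with_proj G) \<and> co_point_determining G)))\<bar> =
         fact (n - 1)"
proof -
  obtain m where "n = Suc m" using assms by (cases n) auto
  then show ?thesis using card_unlabeled_connected_eq[OF assms] card_labeled_connected_diff[of m] labeled_conn_pd_no_isolated[of n] assms by simp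
qed

end
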